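(* Let $X$ be a complete Finsler manifold, $f\in C^1(X,\mathbb{R})$, $Y$ a pseudo-gradient vector field for $f$, and $\varphi^t$ the flow of $Y$. Let $(N,L)$ be an index pair for $\varphi^t$ and $V=\overline{N-L}$. Assume that $f$ is bounded on $V$ and that $f$ satisfies the Palais-Smale condition in $V$. Then $f$ has at least $\nu_H(N/L,[L])$ critical points in $V$. Moreover, if $(N,L)$ is a regular index pair, then $f$ has at least $\nu_H(N,L)$ critical points in $V$.
   Context: $\mathbb{R}^+=[0,\infty)$. A pseudo-gradient vector field for $f\in C^1(X,\mathbb{R})$ is a map $Y:X\to T(X)$ (a vector field) such that (i) the equation $\dot x=Y(x)$ has a unique solution for every initial point $x_0\in X$; (ii) $Y.f:=\langle Df(x),Y(x)\rangle\ge\alpha(\|Df(x)\|)$, where $\alpha$ is a strictly increasing continuous function with $\alpha(0)=0$; (iii) $\|Y\|$ is bounded. Its solutions define a continuous flow $\varphi^t$ on $X$. Palais-Smale condition in $V$: any sequence $\{x_n\}\subset V$ such that $f(x_n)$ is bounded and $\|Df(x_n)\|\to0$ possesses a convergent subsequence. An isolated invariant set of $\varphi^t$ is a subset $I\subset X$ which is the maximal invariant subset of some closed neighborhood of itself; such a closed neighborhood is called an isolating neighborhood for $I$. For a closed pair $(N,L)$ in $X$ (closed sets $L\subset N\subset X$), $N/L$ is the quotient space obtained by collapsing $L$ to a point $[L]$; points other than $[L]$ are identified with points of $N-L$. (If $L=\varnothing$, $N/L$ is $N$ with an isolated point $[L]$ added.) The induced semi-flow on $N/L$ is $\varphi^t_\sharp(x)=\varphi^t(x)$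 if $\varphi^{[0,t]}(x)\subset N-L$, and $\varphi^t_\sharp(x)=[L]$ otherwise, where $\varphi^{[0,t]}(x)=\{\varphi^s(x):0\le s\le t\}$. An index pair is a closed pair $(N,L)$ such that $\overline{N-L}$ is an isolating neighborhood for some isolated invariant set and $\varphi_\sharp:N/L\times\mathbb{R}^+\to N/L$ is continuous. An index pair $(N,L)$ is regular if the exit time map $\tau_+:N\to[0,+\infty]$, given by $\tau_+(x)=\sup\{t : \varphi^{[0,t]}(x)\subset N-L\}$ for $x\in N-L$ and $\tau_+(x)=0$ for $x\in L$, is continuous. Relative homotopy Lusternik-Schnirelmann category: for a topological space $Z$ and a closed subset $A\subset Z$, $\nu_H(Z,A)$ is the minimum $n$ for which there exists an open covering $Z=U_0\cup\cdots\cup U_n$ such that $A$ is a deformation retract of $U_0$ and, for $1\le i\le n$, $U_i\subset Z-A$ is contractible in $Z-A$ (i.e. the inclusion $U_i\hookrightarrow Z-A$ is homotopic to a constant map); $\nu_H(Z,A)=+\infty$ if no such covering exists.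
   Formalization: An index pair is additionally required to have its isolated invariant set contained in N−L; without this the first claim fails (source at 0 in the plane, N the unit disk, L = {0} with the boundary circle). For regular index pairs the condition is automatic. *)

theory Defs
  imports "HOL-Analysis.Analysis" "HOL-Library.Extended_Nat"
begin

section \<open>\<open>C\<^sup>1\<close> Banach manifolds\<close>

text \<open>The manifold is a topological space (a type \<open>'a\<close>) together with an atlas \<open>A\<close> of charts into a
  Banach space \<open>'b\<close>. A chart is a pair \<open>(U, \<psi>)\<close>; only the values of \<open>\<psi>\<close> on \<open>U\<close> matter.\<close>

type_synonym ('a, 'b) chart = "'a set \<times> ('a \<Rightarrow> 'b)"

definition C1_on :: "'b::real_normed_vector set \<Rightarrow> ('b \<Rightarrow> 'c::real_normed_vector) \<Rightarrow> bool" where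
  "C1_on S g \<longleftrightarrow>
     (\<exists>g'. (\<forall>u\<in>S. (g has_derivative blinfun_apply (g' u)) (at u)) \<and> continuous_on S g')"

definition in_chart :: "('a, 'b) chart \<Rightarrow> ('a \<Rightarrow> 'c) \<Rightarrow> 'b \<Rightarrow> 'c" where
  "in_chart c g = g \<circ> inv_into (fst c) (snd c)"

definition C1_banach_manifold :: "('a::topological_space, 'b::banach) chart set \<Rightarrow> bool" where
  "C1_banach_manifold A \<longleftrightarrow>
     (\<Union>c\<in>A. fst c) = UNIV \<and>
     (\<forall>c\<in>A. open (fst c) \<and> open (snd c ` fst c) \<and>
        homeomorphism (fst c) (snd c ` fst c) (snd c) (inv_into (fst c) (snd c))) \<and>
     (\<forall>c\<in>A. \<forall>c'\<in>A. C1_on (snd c ` (fst c \<inter> fst c')) (in_chart c (snd c')))"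

text \<open>A tangent vector at \<open>x\<close> is the family of its representatives in all the charts around \<open>x\<close>, any
  two of them related by the derivative of the coordinate change. The value at a chart that is not
  a chart around \<open>x\<close> is set to 0, so that equal tangent vectors are equal functions.\<close>

type_synonym ('a, 'b) tvec = "('a, 'b) chart \<Rightarrow> 'b"

definition tangent_space :: "('a, 'b::banach) chart set \<Rightarrow> 'a \<Rightarrow> ('a, 'b) tvec set" where
  "tangent_space A x =
     {v. (\<forall>c\<in>A. \<forall>c'\<in>A. x \<in> fst c \<longrightarrow> x \<in> fst c' \<longrightarrow>
            v c' = frechet_derivative (in_chart c (snd c')) (at (snd c x)) (v c)) \<and>
         (\<forall>c. c \<notin> A \<or> x \<notin> fst c \<longrightarrow> v c = 0)}"

definition C1_function :: "('a, 'b::banach) chart set \<Rightarrow> ('a \<Rightarrow> real) \<Rightarrow> bool" where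
  "C1_function A f \<longleftrightarrow> (\<forall>c\<in>A. C1_on (snd c ` fst c) (in_chart c f))"

text \<open>\<open>differential A f x v\<close> is \<open>\<langle>Df(x), v\<rangle>\<close>. By the chain rule it does not depend on the chart used
  to compute it.\<close>

definition differential ::
  "('a, 'b::banach) chart set \<Rightarrow> ('a \<Rightarrow> real) \<Rightarrow> 'a \<Rightarrow> ('a, 'b) tvec \<Rightarrow> real" where
  "differential A f x v =
     (let c = (SOME c. c \<in> A \<and> x \<in> fst c)
      in frechet_derivative (in_chart c f) (at (snd c x)) (v c))"

definition critical_points :: "('a, 'b::banach) chart set \<Rightarrow> ('a \<Rightarrow> real) \<Rightarrow> 'a set" where
  "critical_points A f = {x. \<forall>v\<in>tangent_space A x. differential A f x v = 0}"


section \<open>Finsler manifolds\<close>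

text \<open>Finsler structures in the sense of Palais: an admissible norm on each tangent space such that,
  in each local trivialization of the tangent bundle and for each \<open>k > 1\<close>, the norms at points near
  \<open>x\<close> differ from the norm at \<open>x\<close> at most by the factor \<open>k\<close>. Continuity on the tangent bundle
  follows from these conditions.\<close>

definition finsler_structure ::
  "('a::topological_space, 'b::banach) chart set \<Rightarrow> ('a \<Rightarrow> ('a, 'b) tvec \<Rightarrow> real) \<Rightarrow> bool" where
  "finsler_structure A nrm \<longleftrightarrow>
     (\<forall>x. \<forall>v\<in>tangent_space A x. \<forall>w\<in>tangent_space A x.
        nrm x (\<lambda>c. v c + w c) \<le> nrm x v + nrm x w) \<and>
     (\<forall>x. \<forall>v\<in>tangent_space A x. \<forall>r::real. nrm x (\<lambda>c. r *\<^sub>R v c) = \<bar>r\<bar> * nrm x v) \<and>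
     (\<forall>c\<in>A. \<forall>x\<in>fst c. \<exists>m>0. \<exists>M. \<forall>v\<in>tangent_space A x.
        m * norm (v c) \<le> nrm x v \<and> nrm x v \<le> M * norm (v c)) \<and>
     (\<forall>c\<in>A. \<forall>x\<in>fst c. \<forall>k>1. \<forall>\<^sub>F y in nhds x.
        \<forall>v\<in>tangent_space A x. \<forall>w\<in>tangent_space A y. v c = w c \<longrightarrow>
          nrm x v / k \<le> nrm y w \<and> nrm y w \<le> k * nrm x v)"

text \<open>\<open>w\<close> is the velocity field of the \<open>C\<^sup>1\<close> path \<open>\<gamma>\<close>.\<close>

definition C1_path ::
  "('a::topological_space, 'b::banach) chart set \<Rightarrow> (real \<Rightarrow> 'a) \<Rightarrow> (real \<Rightarrow> ('a, 'b) tvec) \<Rightarrow> bool"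
  where
  "C1_path A \<gamma> w \<longleftrightarrow>
     continuous_on {0..1} \<gamma> \<and>
     (\<forall>t\<in>{0..1}. w t \<in> tangent_space A (\<gamma> t)) \<and>
     (\<forall>c\<in>A. (\<forall>t\<in>{0..1}. \<gamma> t \<in> fst c \<longrightarrow>
                ((snd c \<circ> \<gamma>) has_vector_derivative w t c) (at t within {0..1})) \<and>
             continuous_on {t \<in> {0..1}. \<gamma> t \<in> fst c} (\<lambda>t. w t c))"

text \<open>Meaningful for points in the same component, which are the ones joined by a \<open>C\<^sup>1\<close> path.\<close>

definition finsler_dist ::
  "('a::topological_space, 'b::banach) chart set \<Rightarrow> ('a \<Rightarrow> ('a, 'b) tvec \<Rightarrow> real) \<Rightarrow> 'a \<Rightarrow> 'a \<Rightarrow> real"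
  where
  "finsler_dist A nrm x y =
     Inf {integral {0..1} (\<lambda>t. nrm (\<gamma> t) (w t)) | \<gamma> w. C1_path A \<gamma> w \<and> \<gamma> 0 = x \<and> \<gamma> 1 = y}"

text \<open>The regularity of the underlying topological space, which is part of Palais's definition, is
  expressed by the sort \<open>t3_space\<close>. Complete means that each component is a complete metric space.\<close>

definition complete_finsler_manifold ::
  "('a::t3_space, 'b::banach) chart set \<Rightarrow> ('a \<Rightarrow> ('a, 'b) tvec \<Rightarrow> real) \<Rightarrow> bool" where
  "complete_finsler_manifold A nrm \<longleftrightarrow>
     C1_banach_manifold A \<and> finsler_structure A nrm \<and>
     (\<forall>C\<in>components UNIV. \<forall>\<sigma>::nat \<Rightarrow> 'a. range \<sigma> \<subseteq> C \<longrightarrow>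
        (\<forall>e>0. \<exists>M. \<forall>m\<ge>M. \<forall>n\<ge>M. finsler_dist A nrm (\<sigma> m) (\<sigma> n) < e) \<longrightarrow>
        (\<exists>l\<in>C. (\<lambda>n. finsler_dist A nrm (\<sigma> n) l) \<longlonglongrightarrow> 0))"

text \<open>The dual norm of \<open>Df(x)\<close>.\<close>

definition differential_norm ::
  "('a, 'b::banach) chart set \<Rightarrow> ('a \<Rightarrow> ('a, 'b) tvec \<Rightarrow> real) \<Rightarrow> ('a \<Rightarrow> real) \<Rightarrow> 'a \<Rightarrow> real" where
  "differential_norm A nrm f x =
     Sup {\<bar>differential A f x v\<bar> | v. v \<in> tangent_space A x \<and> nrm x v \<le> 1}"

definition palais_smale ::
  "('a::topological_space, 'b::banach) chart set \<Rightarrow> ('a \<Rightarrow> ('a, 'b) tvec \<Rightarrow> real) \<Rightarrow>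
   ('a \<Rightarrow> real) \<Rightarrow> 'a set \<Rightarrow> bool" where
  "palais_smale A nrm f V \<longleftrightarrow>
     (\<forall>\<sigma>::nat \<Rightarrow> 'a. range \<sigma> \<subseteq> V \<longrightarrow> bounded (range (f \<circ> \<sigma>)) \<longrightarrow>
        (\<lambda>n. differential_norm A nrm f (\<sigma> n)) \<longlonglongrightarrow> 0 \<longrightarrow>
        (\<exists>l r. strict_mono (r::nat \<Rightarrow> nat) \<and> (\<sigma> \<circ> r) \<longlonglongrightarrow> l))"


section \<open>Pseudo-gradient vector fields and their flows\<close>

definition integral_curve ::
  "('a::topological_space, 'b::banach) chart set \<Rightarrow> ('a \<Rightarrow> ('a, 'b) tvec) \<Rightarrow> real set \<Rightarrow>
   (real \<Rightarrow> 'a) \<Rightarrow> bool" where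
  "integral_curve A Y J \<gamma> \<longleftrightarrow>
     continuous_on J \<gamma> \<and>
     (\<forall>t\<in>J. \<forall>c\<in>A. \<gamma> t \<in> fst c \<longrightarrow>
        ((snd c \<circ> \<gamma>) has_vector_derivative Y (\<gamma> t) c) (at t))"

definition unique_solutions ::
  "('a::topological_space, 'b::banach) chart set \<Rightarrow> ('a \<Rightarrow> ('a, 'b) tvec) \<Rightarrow> bool" where
  "unique_solutions A Y \<longleftrightarrow>
     (\<forall>x. (\<exists>\<epsilon>>0. \<exists>\<gamma>. integral_curve A Y {-\<epsilon><..<\<epsilon>} \<gamma> \<and> \<gamma> 0 = x) \<and>
          (\<forall>a b a' b' \<gamma> \<gamma>'.
             0 \<in> {a<..<b} \<longrightarrow> integral_curve A Y {a<..<b} \<gamma> \<longrightarrow> \<gamma> 0 = x \<longrightarrow>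
             0 \<in> {a'<..<b'} \<longrightarrow> integral_curve A Y {a'<..<b'} \<gamma>' \<longrightarrow> \<gamma>' 0 = x \<longrightarrow>
             (\<forall>t\<in>{a<..<b} \<inter> {a'<..<b'}. \<gamma> t = \<gamma>' t)))"

definition pseudo_gradient ::
  "('a::topological_space, 'b::banach) chart set \<Rightarrow> ('a \<Rightarrow> ('a, 'b) tvec \<Rightarrow> real) \<Rightarrow>
   ('a \<Rightarrow> real) \<Rightarrow> ('a \<Rightarrow> ('a, 'b) tvec) \<Rightarrow> bool" where
  "pseudo_gradient A nrm f Y \<longleftrightarrow>
     (\<forall>x. Y x \<in> tangent_space A x) \<and>
     unique_solutions A Y \<and>
     (\<exists>\<alpha>::real \<Rightarrow> real. strict_mono_on {0..} \<alpha> \<and> continuous_on {0..} \<alpha> \<and> \<alpha> 0 = 0 \<and>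
        (\<forall>x. differential A f x (Y x) \<ge> \<alpha> (differential_norm A nrm f x))) \<and>
     (\<exists>B. \<forall>x. nrm x (Y x) \<le> B)"

text \<open>The continuous flow defined by the solutions of \<open>\<gamma>' = Y(\<gamma>)\<close>; the group law is a consequence
  of the uniqueness of solutions.\<close>

definition flow_of ::
  "('a::topological_space, 'b::banach) chart set \<Rightarrow> ('a \<Rightarrow> ('a, 'b) tvec) \<Rightarrow>
   (real \<Rightarrow> 'a \<Rightarrow> 'a) \<Rightarrow> bool" where
  "flow_of A Y \<phi> \<longleftrightarrow>
     (\<forall>x. \<phi> 0 x = x \<and> integral_curve A Y UNIV (\<lambda>t. \<phi> t x)) \<and>
     continuous_on UNIV (\<lambda>(t, x). \<phi> t x)"


section \<open>Index pairs\<close>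

definition invariant_set :: "(real \<Rightarrow> 'a \<Rightarrow> 'a) \<Rightarrow> 'a set \<Rightarrow> bool" where
  "invariant_set \<phi> S \<longleftrightarrow> (\<forall>t. \<phi> t ` S = S)"

definition isolating_neighborhood ::
  "(real \<Rightarrow> 'a::topological_space \<Rightarrow> 'a) \<Rightarrow> 'a set \<Rightarrow> 'a set \<Rightarrow> bool" where
  "isolating_neighborhood \<phi> V I \<longleftrightarrow>
     closed V \<and> I \<subseteq> interior V \<and> invariant_set \<phi> I \<and>
     (\<forall>S. invariant_set \<phi> S \<and> S \<subseteq> V \<longrightarrow> S \<subseteq> I)"

text \<open>The quotient \<open>N/L\<close>: the collapsed point \<open>[L]\<close> is \<open>None\<close>, the point \<open>x\<close> of \<open>N - L\<close> is \<open>Some x\<close>.\<close>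

definition collapse :: "'a set \<Rightarrow> 'a \<Rightarrow> 'a option" where
  "collapse L x = (if x \<in> L then None else Some x)"

definition quotient_space :: "'a::topological_space set \<Rightarrow> 'a set \<Rightarrow> 'a option topology" where
  "quotient_space N L =
     topology (\<lambda>W. W \<subseteq> insert None (Some ` (N - L)) \<and>
                   openin (top_of_set N) {x \<in> N. collapse L x \<in> W})"

lemma openin_quotient_space:
  "openin (quotient_space N L) W \<longleftrightarrow>
     W \<subseteq> insert None (Some ` (N - L)) \<and> openin (top_of_set N) {x \<in> N. collapse L x \<in> W}"
proof -
  have "istopology (\<lambda>W. W \<subseteq> insert None (Some ` (N - L)) \<and>
          openin (top_of_set N) {x \<in> N. collapse L x \<in> W})"
  proof -
    have int: "{x \<in> N. collapse L x \<in> S \<inter> T} =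
        {x \<in> N. collapse L x \<in> S} \<inter> {x \<in> N. collapse L x \<in> T}" for S T
      by auto
    have un: "{x \<in> N. collapse L x \<in> \<Union>K} = (\<Union>S\<in>K. {x \<in> N. collapse L x \<in> S})" for K
      by auto
    show ?thesis
      unfolding istopology_def
    proof (intro conjI allI impI)
      fix S T
      assume S: "S \<subseteq> insert None (Some ` (N - L)) \<and> openin (top_of_set N) {x \<in> N. collapse L x \<in> S}"
        and T: "T \<subseteq> insert None (Some ` (N - L)) \<and> openin (top_of_set N) {x \<in> N. collapse L x \<in> T}"
      show "S \<inter> T \<subseteq> insert None (Some ` (N - L))"
        using S by blast
      show "openin (top_of_set N) {x \<in> N. collapse L x \<in> S \<inter> T}"
        unfolding int using S T by (intro openin_Int) auto
    next
      fix K
      assume K: "\<forall>S\<in>K. S \<subseteq> insert None (Some ` (N - L)) \<and>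
                   openin (top_of_set N) {x \<in> N. collapse L x \<in> S}"
      show "\<Union>K \<subseteq> insert None (Some ` (N - L))"
        using K by blast
      show "openin (top_of_set N) {x \<in> N. collapse L x \<in> \<Union>K}"
        unfolding un using K by (intro openin_Union) auto
    qed
  qed
  then show ?thesis
    by (simp add: quotient_space_def)
qed

lemma topspace_quotient_space:
  "L \<subseteq> N \<Longrightarrow> topspace (quotient_space N L) = insert None (Some ` (N - L))"
proof -
  have "{x \<in> N. collapse L x \<in> insert None (Some ` (N - L))} = N"
    by (auto simp: collapse_def)
  then have "openin (quotient_space N L) (insert None (Some ` (N - L)))"
    by (simp add: openin_quotient_space)
  then show ?thesis
    by (metis openin_quotient_space openin_subset openin_topspace subset_antisym)
qed

definition induced_semiflow ::
  "(real \<Rightarrow> 'a \<Rightarrow> 'a) \<Rightarrow> 'a set \<Rightarrow> 'a set \<Rightarrow> real \<Rightarrow> 'a option \<Rightarrow> 'a option" where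
  "induced_semiflow \<phi> N L t z =
     (case z of
        None \<Rightarrow> None
      | Some x \<Rightarrow> if \<forall>s\<in>{0..t}. \<phi> s x \<in> N - L then Some (\<phi> t x) else None)"

text \<open>The isolated invariant set is required to lie in \<open>N - L\<close>, i.e. \<open>N - L\<close> (and not only its closure)
  is a neighborhood of it, as is usual for index pairs. This is not automatic: for the flow of a
  source at 0 in the plane, the unit disk \<open>N\<close> and \<open>L = {0} \<union> \<partial>N\<close> satisfy all the other conditions,
  and \<open>N/L\<close> is a sphere with two points identified, of relative category 2, although there is
  only one critical point. For a regular pair the requirement follows from the other ones.\<close>

definition index_pair ::
  "(real \<Rightarrow> 'a::topological_space \<Rightarrow> 'a) \<Rightarrow> 'a set \<Rightarrow> 'a set \<Rightarrow> bool" where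
  "index_pair \<phi> N L \<longleftrightarrow>
     closed N \<and> closed L \<and> L \<subseteq> N \<and>
     (\<exists>I. isolating_neighborhood \<phi> (closure (N - L)) I \<and> I \<subseteq> N - L) \<and>
     continuous_map (prod_topology (quotient_space N L) (top_of_set {0..})) (quotient_space N L)
       (\<lambda>(z, t). induced_semiflow \<phi> N L t z)"

definition exit_time :: "(real \<Rightarrow> 'a \<Rightarrow> 'a) \<Rightarrow> 'a set \<Rightarrow> 'a set \<Rightarrow> 'a \<Rightarrow> ereal" where
  "exit_time \<phi> N L x =
     (if x \<in> N - L then Sup {ereal t | t. 0 \<le> t \<and> (\<forall>s\<in>{0..t}. \<phi> s x \<in> N - L)} else 0)"

definition regular_index_pair ::
  "(real \<Rightarrow> 'a::topological_space \<Rightarrow> 'a) \<Rightarrow> 'a set \<Rightarrow> 'a set \<Rightarrow> bool" where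
  "regular_index_pair \<phi> N L \<longleftrightarrow> index_pair \<phi> N L \<and> continuous_on N (exit_time \<phi> N L)"


section \<open>Relative homotopy Lusternik-Schnirelmann category\<close>

text \<open>The homotopy is required to fix \<open>A\<close> pointwise. Without this requirement the category below
  could only become smaller.\<close>

definition deformation_retract_in :: "'z topology \<Rightarrow> 'z set \<Rightarrow> 'z set \<Rightarrow> bool" where
  "deformation_retract_in Z A U \<longleftrightarrow>
     A \<subseteq> U \<and>
     (\<exists>r. retraction_maps (subtopology Z U) (subtopology Z A) r id \<and>
          homotopic_with (\<lambda>h. \<forall>a\<in>A. h a = a) (subtopology Z U) (subtopology Z U) id r)"

definition contractible_in :: "'z topology \<Rightarrow> 'z set \<Rightarrow> 'z set \<Rightarrow> bool" where
  "contractible_in Z U B \<longleftrightarrow>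
     (\<exists>a. homotopic_with (\<lambda>_. True) (subtopology Z U) (subtopology Z B) id (\<lambda>_. a))"

text \<open>The infimum of the empty set is \<open>\<infinity>\<close>.\<close>

definition relative_category :: "'z topology \<Rightarrow> 'z set \<Rightarrow> enat" where
  "relative_category Z A =
     Inf {enat n | n. \<exists>U::nat \<Rightarrow> 'z set.
       (\<forall>i\<le>n. openin Z (U i)) \<and> (\<Union>i\<le>n. U i) = topspace Z \<and>
       deformation_retract_in Z A (U 0) \<and>
       (\<forall>i\<in>{1..n}. U i \<subseteq> topspace Z - A \<and> contractible_in Z (U i) (topspace Z - A))}"

definition ecard :: "'a set \<Rightarrow> enat" where
  "ecard S = (if finite S then enat (card S) else \<infinity>)"

end

theory Submission
  imports Defs
begin

text \<open>Only the rest points \<open>r\<close> of the flow in \<open>V\<close> matter; all of them are critical. By the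
  Palais-Smale condition \<open>f\<close> gains a definite amount in unit time along orbit segments in \<open>V\<close> that
  start away from the rest points. Since \<open>f\<close> is bounded on \<open>V\<close>, every orbit leaves \<open>N - L\<close> or is close
  to some \<open>r\<close> at one of boundedly many integer times. The points of \<open>N - L\<close> that visit a small
  neighborhood of \<open>r\<close> form an open set, which is pushed along the flow into a contractible neighborhood
  of \<open>r\<close>; the points that leave \<open>N - L\<close> form an open neighborhood of \<open>[L]\<close> that the flow
  retracts to \<open>[L]\<close>, and in the regular case to \<open>L\<close>, following each orbit up to its exit
  time.\<close>

section \<open>Charts, differentials and flow lines\<close>

text \<open>Neither the exit time from \<open>N - L\<close> nor the time of a visit near a rest
  point depends continuously on the point. Both are replaced by continuous data taken from the
  semiflow on \<open>N/L\<close>: bump functions vanishing on \<open>L\<close>, sampled along the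
  semiflow at integer times, are continuous even where orbits leave, and serve as weights of an
  averaged visiting time. An averaged time need not be the time of a visit, which is why nested
  neighborhoods with a no-return property appear. The retraction to \<open>[L]\<close> stretches
  infinite time over the unit interval; its continuity at the end rests on a neighborhood of
  \<open>[L]\<close> that collapses within a fixed time. A critical point at which the field does
  not vanish is harmless, because orbits pass through it: among finitely many zeros of the slope, an
  orbit segment on which \<open>f\<close> is constant must be stationary.\<close>

lemma open_closure_subset_nbhd:
  fixes x :: "'a::t3_space"
  assumes "open G" "x \<in> G"
  obtains W where "open W" "x \<in> W" "closure W \<subseteq> G"
proof -
  obtain W T where WT: "open W" "open T" "x \<in> W" "- G \<subseteq> T" "W \<inter> T = {}"
    using t3_space[of "- G" x] assms by auto
  then have "closure W \<subseteq> - T"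
    by (intro closure_minimal) auto
  with WT that show thesis by blast
qed

lemma chart_at:
  assumes "C1_banach_manifold A"
  obtains c where "c \<in> A" "x \<in> fst c"
proof -
  have "x \<in> (\<Union>c\<in>A. fst c)" using assms by (simp add: C1_banach_manifold_def)
  with that show thesis by blast
qed

lemma chart_homeomorphism:
  assumes "C1_banach_manifold A" "c \<in> A"
  shows "open (fst c)" "open (snd c ` fst c)"
    and "continuous_on (fst c) (snd c)"
    and "continuous_on (snd c ` fst c) (inv_into (fst c) (snd c))"
    and "inj_on (snd c) (fst c)"
    and "\<And>T. open T \<Longrightarrow> open (snd c ` (fst c \<inter> T))"
proof -
  have *: "open (fst c)" "open (snd c ` fst c)"
    "homeomorphism (fst c) (snd c ` fst c) (snd c) (inv_into (fst c) (snd c))"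
    using assms unfolding C1_banach_manifold_def by auto
  show "open (fst c)" "open (snd c ` fst c)" "continuous_on (fst c) (snd c)"
    "continuous_on (snd c ` fst c) (inv_into (fst c) (snd c))"
    using * by (auto simp: homeomorphism_def)
  show "inj_on (snd c) (fst c)"
    using *(3) by (intro inj_on_inverseI) (rule homeomorphism_apply1)
  show "open (snd c ` (fst c \<inter> T))" if "open T" for T
    using homeomorphism_imp_open_map[OF *(3) openin_open_Int[OF that]] *(2)
    by (rule openin_open_trans)
qed

text \<open>A cone function in one chart, extended by zero. The closure of a chart ball could leave
  the chart domain; regularity supplies \<open>W\<close> with closure inside the domain, so that
  \<open>fst c\<close> and \<open>- closure W\<close> are open, cover the space and carry continuous
  pieces.\<close>

lemma manifold_bump_function:
  fixes A :: "('a::t3_space, 'b::banach) chart set"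
  assumes A: "C1_banach_manifold A" and G: "open G" "x \<in> G"
  obtains \<rho> :: "'a \<Rightarrow> real"
  where "continuous_on UNIV \<rho>" "\<rho> x = 1" "\<And>y. 0 \<le> \<rho> y" "\<And>y. y \<notin> G \<Longrightarrow> \<rho> y = 0"
proof -
  obtain c where c: "c \<in> A" "x \<in> fst c" using chart_at[OF A] .
  note ch = chart_homeomorphism[OF A c(1)]
  obtain W where W: "open W" "x \<in> W" "closure W \<subseteq> G \<inter> fst c"
    using open_closure_subset_nbhd[of "G \<inter> fst c" x] G c ch(1) by auto
  have Wc: "W \<subseteq> G \<inter> fst c" using W(3) closure_subset by blast
  have "open (snd c ` (fst c \<inter> W))" "snd c x \<in> snd c ` (fst c \<inter> W)"
    using ch(6)[OF W(1)] W c by auto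
  then obtain r where r: "r > 0" "ball (snd c x) r \<subseteq> snd c ` (fst c \<inter> W)"
    by (meson openE)
  have far: "dist (snd c x) (snd c y) \<ge> r" if "y \<in> fst c" "y \<notin> W" for y
  proof (rule ccontr)
    assume "\<not> ?thesis"
    then have "snd c y \<in> snd c ` (fst c \<inter> W)" using r by auto
    then show False using that ch(5) by (auto dest: inj_onD)
  qed
  define \<rho> where "\<rho> y = (if y \<in> fst c then max 0 (1 - dist (snd c x) (snd c y) / r) else 0)" for y
  have \<rho>_ge: "0 \<le> \<rho> y" for y by (simp add: \<rho>_def)
  have zero: "\<rho> y = 0" if "y \<notin> W" for y
  proof (cases "y \<in> fst c")
    case True
    then have "1 - dist (snd c x) (snd c y) / r \<le> 0"
      using far[OF _ that] r(1) by (simp add: field_simps)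
    then show ?thesis by (simp add: \<rho>_def)
  qed (simp add: \<rho>_def)
  have "continuous_on (fst c) (\<lambda>y. max 0 (1 - dist (snd c x) (snd c y) / r))"
    by (intro continuous_intros ch(3)) (use r in auto)
  then have 1: "continuous_on (fst c) \<rho>"
    by (rule continuous_on_eq) (simp add: \<rho>_def)
  have 2: "continuous_on (- closure W) \<rho>"
    by (rule continuous_on_eq[of _ "\<lambda>_. 0"]) (use zero closure_subset in \<open>auto intro!: continuous_intros\<close>)
  have "continuous_on (fst c \<union> - closure W) \<rho>"
    by (rule continuous_on_open_Un[OF ch(1) _ 1 2]) auto
  moreover have "fst c \<union> - closure W = UNIV" using W(3) by auto
  ultimately have "continuous_on UNIV \<rho>" by simp
  then show thesis
    by (rule that) (use zero Wc c in \<open>auto simp: \<rho>_def[of x] intro: \<rho>_ge\<close>)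
qed

text \<open>A ball in the chart is convex; its straight-line contraction is conjugated by the
  chart.\<close>

lemma manifold_contractible_nbhd:
  fixes A :: "('a::t3_space, 'b::banach) chart set" and G :: "'a set"
  assumes A: "C1_banach_manifold A" and G: "open G" "x \<in> G"
  obtains B where "open B" "x \<in> B" "B \<subseteq> G"
    "homotopic_with_canon (\<lambda>_. True) B B id (\<lambda>_. x)"
proof -
  obtain c where c: "c \<in> A" "x \<in> fst c" using chart_at[OF A] .
  note ch = chart_homeomorphism[OF A c(1)]
  define g where "g = inv_into (fst c) (snd c)"
  have g: "g (snd c y) = y" if "y \<in> fst c" for y
    using that ch(5) by (simp add: g_def)
  have "open (snd c ` (fst c \<inter> G))" "snd c x \<in> snd c ` (fst c \<inter> G)"
    using ch(6)[OF G(1)] G c by auto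
  then obtain r where r: "r > 0" "ball (snd c x) r \<subseteq> snd c ` (fst c \<inter> G)"
    by (meson openE)
  define B where "B = fst c \<inter> snd c -` ball (snd c x) r"
  have B1: "open B"
    unfolding B_def by (rule continuous_open_preimage[OF ch(3,1)]) auto
  have B2: "x \<in> B" using c r by (simp add: B_def)
  have B3: "B \<subseteq> G"
  proof
    fix y assume "y \<in> B"
    then have "y \<in> fst c" "snd c y \<in> snd c ` (fst c \<inter> G)" using r by (auto simp: B_def)
    then show "y \<in> G" using ch(5) by (auto dest: inj_onD)
  qed
  have gB: "g \<in> ball (snd c x) r \<rightarrow> B"
  proof
    fix u assume u: "u \<in> ball (snd c x) r"
    then obtain y where "y \<in> fst c" "u = snd c y" using r by blast
    then show "g u \<in> B" using u by (simp add: B_def g)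
  qed
  have sB: "snd c \<in> B \<rightarrow> ball (snd c x) r" by (auto simp: B_def)
  have "homotopic_with_canon (\<lambda>_. True) (ball (snd c x) r) (ball (snd c x) r) id (\<lambda>_. snd c x)"
  proof (rule homotopic_with_linear)
    fix u assume "u \<in> ball (snd c x) r"
    then show "closed_segment (id u) (snd c x) \<subseteq> ball (snd c x) r"
      using r by (intro closed_segment_subset) auto
  qed (auto intro: continuous_intros)
  then have "homotopic_with_canon (\<lambda>_. True) (ball (snd c x) r) B (g \<circ> id) (g \<circ> (\<lambda>_. snd c x))"
    by (rule homotopic_with_compose_continuous_left)
      (use gB r in \<open>auto simp: g_def intro!: continuous_on_subset[OF ch(4)]\<close>)
  then have "homotopic_with_canon (\<lambda>_. True) B B (g \<circ> id \<circ> snd c) (g \<circ> (\<lambda>_. snd c x) \<circ> snd c)"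
    by (rule homotopic_with_compose_continuous_right)
      (use sB in \<open>auto simp: B_def intro!: continuous_on_subset[OF ch(3)]\<close>)
  then have "homotopic_with_canon (\<lambda>_. True) B B id (\<lambda>_. x)"
    by (rule homotopic_with_eq) (use g c in \<open>auto simp: B_def\<close>)
  then show thesis by (rule that[OF B1 B2 B3])
qed

section \<open>Differentials in charts and the dual norm\<close>

lemma in_chart_has_derivative:
  assumes f: "C1_function A f" and c: "c \<in> A" "x \<in> fst c"
  shows "(in_chart c f has_derivative frechet_derivative (in_chart c f) (at (snd c x))) (at (snd c x))"
proof -
  obtain g' where "\<forall>u\<in>snd c ` fst c. (in_chart c f has_derivative blinfun_apply (g' u)) (at u)"
    using f c unfolding C1_function_def C1_on_def by blast
  then show ?thesis
    using c by (metis frechet_derivative_at imageI)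
qed

lemma C1_function_continuous:
  fixes A :: "('a::t2_space, 'b::banach) chart set"
  assumes A: "C1_banach_manifold A" and f: "C1_function A f"
  shows "continuous_on UNIV f"
proof -
  have "isCont f x" for x
  proof -
    obtain c where c: "c \<in> A" "x \<in> fst c" using chart_at[OF A] .
    note ch = chart_homeomorphism[OF A c(1)]
    have "isCont (in_chart c f) (snd c x)"
      using in_chart_has_derivative[OF f c] has_derivative_continuous by blast
    moreover have "isCont (snd c) x"
      using ch(1,3) c(2) continuous_on_eq_continuous_at by blast
    ultimately have "isCont (\<lambda>y. in_chart c f (snd c y)) x"
      by (rule isCont_o2[rotated])
    moreover have "\<forall>\<^sub>F y in nhds x. in_chart c f (snd c y) = f y"
      using eventually_nhds_in_open[OF ch(1) c(2)]
      by eventually_elim (simp add: in_chart_def ch(5))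
    ultimately show ?thesis using isCont_cong by metis
  qed
  then show ?thesis by (simp add: continuous_on_eq_continuous_at)
qed

lemma linear_coordinate_change:
  assumes A: "C1_banach_manifold A" and c: "c \<in> A" "c' \<in> A" "x \<in> fst c" "x \<in> fst c'"
  shows "linear (frechet_derivative (in_chart c (snd c')) (at (snd c x)))"
proof -
  have "C1_on (snd c ` (fst c \<inter> fst c')) (in_chart c (snd c'))"
    using A c unfolding C1_banach_manifold_def by blast
  then have "in_chart c (snd c') differentiable (at (snd c x))"
    using c unfolding C1_on_def differentiable_def by blast
  then show ?thesis by (rule linear_frechet_derivative)
qed

lemma tangent_space_scale:
  assumes A: "C1_banach_manifold A" and v: "v \<in> tangent_space A x"
  shows "(\<lambda>c. r *\<^sub>R v c) \<in> tangent_space A x"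
  unfolding tangent_space_def mem_Collect_eq
proof (intro conjI ballI allI impI)
  fix c c' assume c: "c \<in> A" "c' \<in> A" "x \<in> fst c" "x \<in> fst c'"
  then have "v c' = frechet_derivative (in_chart c (snd c')) (at (snd c x)) (v c)"
    using v unfolding tangent_space_def by blast
  then show "r *\<^sub>R v c' = frechet_derivative (in_chart c (snd c')) (at (snd c x)) (r *\<^sub>R v c)"
    by (simp only: linear_scale[OF linear_coordinate_change[OF A c]])
next
  fix c assume "c \<notin> A \<or> x \<notin> fst c"
  then have "v c = 0" using v unfolding tangent_space_def by blast
  then show "r *\<^sub>R v c = 0" by simp
qed

lemma zero_in_tangent_space:
  assumes A: "C1_banach_manifold A"
  shows "(\<lambda>_. 0) \<in> tangent_space A x"
  unfolding tangent_space_def mem_Collect_eq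
proof (intro conjI ballI allI impI)
  fix c c' assume c: "c \<in> A" "c' \<in> A" "x \<in> fst c" "x \<in> fst c'"
  show "0 = frechet_derivative (in_chart c (snd c')) (at (snd c x)) 0"
    by (rule linear_0[OF linear_coordinate_change[OF A c], symmetric])
qed (rule refl)

lemma finsler_structure_scale:
  assumes "finsler_structure A nrm" "v \<in> tangent_space A x"
  shows "nrm x (\<lambda>c. r *\<^sub>R v c) = \<bar>r\<bar> * nrm x v"
  using assms(1)[unfolded finsler_structure_def, THEN conjunct2, THEN conjunct1] assms(2)
  by blast

text \<open>Exposes the chart chosen by \<open>SOME\<close> in \<open>differential\<close> together
  with the derivative there, so that later computations stay in that same chart.\<close>

lemma differential_chart:
  assumes A: "C1_banach_manifold A" and f: "C1_function A f"
  shows "\<exists>c\<in>A. x \<in> fst c \<and>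
    (\<forall>v. differential A f x v = frechet_derivative (in_chart c f) (at (snd c x)) (v c)) \<and>
    (in_chart c f has_derivative frechet_derivative (in_chart c f) (at (snd c x))) (at (snd c x))"
proof -
  define c where "c = (SOME c. c \<in> A \<and> x \<in> fst c)"
  have c: "c \<in> A" "x \<in> fst c"
    using chart_at[OF A, of x] someI_ex[of "\<lambda>c. c \<in> A \<and> x \<in> fst c"] unfolding c_def by blast+
  have "differential A f x v = frechet_derivative (in_chart c f) (at (snd c x)) (v c)" for v
    by (simp add: differential_def c_def Let_def)
  with c in_chart_has_derivative[OF f c] show ?thesis by blast
qed

lemma differential_scale:
  assumes A: "C1_banach_manifold A" and f: "C1_function A f"
  shows "differential A f x (\<lambda>c. r *\<^sub>R v c) = r * differential A f x v"
proof -
  obtain c where c: "\<And>v. differential A f x v = frechet_derivative (in_chart c f) (at (snd c x)) (v c)"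
    "(in_chart c f has_derivative frechet_derivative (in_chart c f) (at (snd c x))) (at (snd c x))"
    using differential_chart[OF A f, of x] by blast
  show ?thesis
    using has_derivative_linear[OF c(2)] by (simp add: c(1) linear_scale)
qed

text \<open>The real \<open>Sup\<close> in \<open>differential_norm\<close> dominates its elements
  only if they are bounded. The derivative is bounded for the chart norm, and the lower Finsler
  estimate \<open>m\<close> converts this into a bound on the Finsler unit ball.\<close>

lemma bdd_above_differential:
  assumes A: "C1_banach_manifold A" and F: "finsler_structure A nrm" and f: "C1_function A f"
  shows "bdd_above {\<bar>differential A f x v\<bar> | v. v \<in> tangent_space A x \<and> nrm x v \<le> 1}"
proof -
  obtain c where c: "c \<in> A" "x \<in> fst c"
    "\<And>v. differential A f x v = frechet_derivative (in_chart c f) (at (snd c x)) (v c)"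
    "(in_chart c f has_derivative frechet_derivative (in_chart c f) (at (snd c x))) (at (snd c x))"
    using differential_chart[OF A f, of x] by blast
  obtain K where K: "K > 0"
    "\<And>u. norm (frechet_derivative (in_chart c f) (at (snd c x)) u) \<le> norm u * K"
    using bounded_linear.pos_bounded[OF has_derivative_bounded_linear[OF c(4)]] by blast
  obtain m where m: "m > 0" "\<And>v. v \<in> tangent_space A x \<Longrightarrow> m * norm (v c) \<le> nrm x v"
    using F[unfolded finsler_structure_def, THEN conjunct2, THEN conjunct2, THEN conjunct1] c(1,2)
    by meson
  show ?thesis
  proof (rule bdd_aboveI[of _ "K / m"], clarify)
    fix v assume v: "v \<in> tangent_space A x" "nrm x v \<le> 1"
    then have "norm (v c) \<le> 1 / m"
      using m(1) m(2)[OF v(1)] by (simp add: field_simps)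
    then have "norm (v c) * K \<le> 1 / m * K"
      using K(1) by (intro mult_right_mono) auto
    then show "\<bar>differential A f x v\<bar> \<le> K / m"
      using K(2)[of "v c"] by (simp add: c(3))
  qed
qed

lemma differential_norm_nonneg:
  assumes A: "C1_banach_manifold A" and F: "finsler_structure A nrm" and f: "C1_function A f"
  shows "0 \<le> differential_norm A nrm f x"
proof -
  have z: "(\<lambda>_. 0) \<in> tangent_space A x" by (rule zero_in_tangent_space[OF A])
  have "nrm x (\<lambda>_. 0) \<le> 1"
    using finsler_structure_scale[OF F z, of 0] by simp
  then have "\<bar>differential A f x (\<lambda>_. 0)\<bar> \<le> differential_norm A nrm f x"
    unfolding differential_norm_def
    by (intro cSup_upper bdd_above_differential[OF A F f]) (use z in auto)
  then show ?thesis by linarith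
qed

lemma critical_point_if_differential_norm_zero:
  assumes A: "C1_banach_manifold A" and F: "finsler_structure A nrm" and f: "C1_function A f"
    and z: "differential_norm A nrm f x \<le> 0"
  shows "x \<in> critical_points A f"
  unfolding critical_points_def
proof (clarify)
  fix v assume v: "v \<in> tangent_space A x"
  \<comment> \<open>Scales \<open>v\<close> into the unit ball; the \<open>+ 1\<close> keeps the
    denominator positive when \<open>nrm x v\<close> is zero.\<close>
  define r where "r = 1 / (\<bar>nrm x v\<bar> + 1)"
  have r: "r > 0" by (simp add: r_def)
  have "nrm x (\<lambda>c. r *\<^sub>R v c) = \<bar>r\<bar> * nrm x v"
    by (rule finsler_structure_scale[OF F v])
  also have "\<dots> \<le> 1"
    by (simp add: r_def field_simps)
  finally have "\<bar>differential A f x (\<lambda>c. r *\<^sub>R v c)\<bar> \<le> differential_norm A nrm f x"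
    unfolding differential_norm_def
    by (intro cSup_upper bdd_above_differential[OF A F f])
      (use tangent_space_scale[OF A v] in auto)
  then have "\<bar>r * differential A f x v\<bar> \<le> 0"
    using z by (simp add: differential_scale[OF A f])
  then show "differential A f x v = 0" using r by simp
qed

section \<open>Group law and the derivative of \<open>f\<close> along orbits\<close>

lemma flow_add:
  assumes Y: "unique_solutions A Y" and \<phi>: "flow_of A Y \<phi>"
  shows "\<phi> (s + t) x = \<phi> s (\<phi> t x)"
proof -
  have ic: "integral_curve A Y UNIV (\<lambda>u. \<phi> u y)" "\<phi> 0 y = y" for y
    using \<phi> unfolding flow_of_def by auto
  \<comment> \<open>Uniqueness is stated on bounded open intervals around 0, so both curves are cut
    to such a window containing \<open>s\<close>.\<close>
  define r where "r = \<bar>s\<bar> + 1"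
  have sub: "integral_curve A Y {-r<..<r} \<gamma>" if "integral_curve A Y UNIV \<gamma>" for \<gamma>
    using that unfolding integral_curve_def by (auto intro: continuous_on_subset)
  have "integral_curve A Y UNIV (\<lambda>u. \<phi> (u + t) x)"
    unfolding integral_curve_def
  proof (intro conjI ballI impI)
    show "continuous_on UNIV (\<lambda>u. \<phi> (u + t) x)"
      by (rule continuous_on_compose2[of UNIV "\<lambda>u. \<phi> u x" UNIV "\<lambda>u. u + t"])
        (use ic(1)[of x] in \<open>auto simp: integral_curve_def intro: continuous_intros\<close>)
    fix u c assume "c \<in> A" "\<phi> (u + t) x \<in> fst c"
    then have *: "((\<lambda>u. snd c (\<phi> u x)) has_vector_derivative Y (\<phi> (u + t) x) c) (at (u + t))"
      using ic(1)[of x] unfolding integral_curve_def by (auto simp: o_def)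
    have "((\<lambda>u. u + t) has_vector_derivative 1) (at u)"
      by (auto intro!: derivative_eq_intros)
    from vector_diff_chain_at[OF this *]
    show "((snd c \<circ> (\<lambda>u. \<phi> (u + t) x)) has_vector_derivative Y (\<phi> (u + t) x) c) (at u)"
      by (simp add: o_def)
  qed
  note curves = sub[OF this] sub[OF ic(1)[of "\<phi> t x"]]
  have uniq: "\<forall>u\<in>{a<..<b} \<inter> {a'<..<b'}. \<gamma> u = \<gamma>' u"
    if "0 \<in> {a<..<b}" "integral_curve A Y {a<..<b} \<gamma>" "\<gamma> 0 = \<phi> t x"
      "0 \<in> {a'<..<b'}" "integral_curve A Y {a'<..<b'} \<gamma>'" "\<gamma>' 0 = \<phi> t x" for a b a' b' \<gamma> \<gamma>'
    using Y that unfolding unique_solutions_def by presburger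
  have "\<forall>u\<in>{-r<..<r} \<inter> {-r<..<r}. \<phi> (u + t) x = \<phi> u (\<phi> t x)"
    by (rule uniq[OF _ curves(1) _ _ curves(2)]) (auto simp: r_def ic(2))
  moreover have "s \<in> {-r<..<r} \<inter> {-r<..<r}" by (auto simp: r_def)
  ultimately show ?thesis by blast
qed

lemma flow_derivative:
  assumes A: "C1_banach_manifold A" and f: "C1_function A f" and \<phi>: "flow_of A Y \<phi>"
  shows "((\<lambda>t. f (\<phi> t x)) has_real_derivative differential A f (\<phi> t x) (Y (\<phi> t x))) (at t)"
proof -
  define y where "y = \<phi> t x"
  obtain c where c: "c \<in> A" "y \<in> fst c"
    "\<And>v. differential A f y v = frechet_derivative (in_chart c f) (at (snd c y)) (v c)"
    "(in_chart c f has_derivative frechet_derivative (in_chart c f) (at (snd c y))) (at (snd c y))"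
    using differential_chart[OF A f, of y] by blast
  note ch = chart_homeomorphism[OF A c(1)]
  have ic: "integral_curve A Y UNIV (\<lambda>u. \<phi> u x)"
    using \<phi> unfolding flow_of_def by auto
  then have "((\<lambda>u. snd c (\<phi> u x)) has_vector_derivative Y y c) (at t)"
    using c unfolding integral_curve_def by (auto simp: o_def y_def)
  then have d: "((\<lambda>u. snd c (\<phi> u x)) has_derivative (\<lambda>h. h *\<^sub>R Y y c)) (at t)"
    by (simp add: has_vector_derivative_def)
  have "((\<lambda>u. in_chart c f (snd c (\<phi> u x))) has_derivative
      (\<lambda>h. frechet_derivative (in_chart c f) (at (snd c y)) (h *\<^sub>R Y y c))) (at t)"
    using diff_chain_at[OF d] c(4) by (simp add: y_def o_def)
  also have "(\<lambda>h. frechet_derivative (in_chart c f) (at (snd c y)) (h *\<^sub>R Y y c)) =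
      (*) (differential A f y (Y y))"
    using has_derivative_linear[OF c(4)] by (auto simp: c(3) linear_scale)
  finally have *: "((\<lambda>u. in_chart c f (snd c (\<phi> u x))) has_real_derivative
      differential A f y (Y y)) (at t)"
    by (simp add: has_field_derivative_def)
  \<comment> \<open>The chart expression agrees with \<open>f\<close> only over the chart domain;
    the derivative is transferred on the open set of times that the orbit spends there.\<close>
  have "open ((\<lambda>u. \<phi> u x) -` fst c)"
    using ic ch(1) unfolding integral_curve_def by (simp add: open_vimage)
  then have "((\<lambda>t. f (\<phi> t x)) has_real_derivative differential A f y (Y y)) (at t)"
    by (rule has_field_derivative_transform_within_open[OF *])
      (use c(2) in \<open>auto simp: y_def in_chart_def ch(5)\<close>)
  then show ?thesis by (simp add: y_def)
qed

section \<open>Gradient-like flows\<close>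

text \<open>The abstract setting extracted from the manifold. \<open>g\<close> is the slope of
  \<open>f\<close> along the flow, and the Palais-Smale condition is phrased with \<open>g\<close>
  in place of the norm of the differential. Finiteness of the zeros costs nothing, since infinitely
  many critical points make the bounds trivial.\<close>

locale gradient_like_flow =
  fixes \<phi> :: "real \<Rightarrow> 'a::t3_space \<Rightarrow> 'a" and f g :: "'a \<Rightarrow> real" and V :: "'a set"
  assumes flow_zero: "\<phi> 0 x = x"
    and flow_plus: "\<phi> (s + t) x = \<phi> s (\<phi> t x)"
    and flow_continuous: "continuous_on UNIV (\<lambda>(t, x). \<phi> t x)"
    and f_continuous: "continuous_on UNIV f"
    and f_derivative: "((\<lambda>t. f (\<phi> t x)) has_real_derivative g (\<phi> t x)) (at t)"
    and g_nonneg: "0 \<le> g x"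
    and closed_V: "closed V"
    and bounded_V: "bounded (f ` V)"
    and finite_zeros: "finite {x \<in> V. g x = 0}"
    and palais_smale_g: "\<lbrakk>range \<sigma> \<subseteq> V; (\<lambda>n. g (\<sigma> n)) \<longlonglongrightarrow> 0\<rbrakk>
      \<Longrightarrow> \<exists>l r. strict_mono (r :: nat \<Rightarrow> nat) \<and> (\<sigma> \<circ> r) \<longlonglongrightarrow> l"
    and bump_function: "\<lbrakk>open G; x \<in> G\<rbrakk> \<Longrightarrow> \<exists>\<rho> :: 'a \<Rightarrow> real.
      continuous_on UNIV \<rho> \<and> \<rho> x = 1 \<and> (\<forall>y. 0 \<le> \<rho> y) \<and> (\<forall>y. y \<notin> G \<longrightarrow> \<rho> y = 0)"
    and contractible_nbhd: "\<lbrakk>open G; x \<in> G\<rbrakk> \<Longrightarrow> \<exists>B. open B \<and> x \<in> B \<and> B \<subseteq> G \<and>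
      homotopic_with_canon (\<lambda>_. True) B B id (\<lambda>_. x)"
begin

text \<open>A zero of \<open>g\<close> need not be fixed by the flow; only fixed points can keep
  \<open>f\<close> from gaining along a unit segment in \<open>V\<close>.\<close>

definition rest_points :: "'a set" where
  "rest_points = {p \<in> V. \<forall>t. \<phi> t p = p}"

lemma continuous_on_flow [continuous_intros]:
  assumes "continuous_on S a" "continuous_on S b"
  shows "continuous_on S (\<lambda>x. \<phi> (a x) (b x))"
  using continuous_on_compose2[OF flow_continuous continuous_on_Pair[OF assms]] by simp

lemma tendsto_flow:
  assumes "s \<longlonglongrightarrow> t" "\<sigma> \<longlonglongrightarrow> x"
  shows "(\<lambda>n. \<phi> (s n) (\<sigma> n)) \<longlonglongrightarrow> \<phi> t x"
  using continuous_on_tendsto_compose[OF flow_continuous tendsto_Pair[OF assms]] by simp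

lemma tendsto_f:
  assumes "\<sigma> \<longlonglongrightarrow> x"
  shows "(\<lambda>n. f (\<sigma> n)) \<longlonglongrightarrow> f x"
  using f_continuous assms continuous_on_tendsto_compose by fastforce

lemma f_flow_mono: "s \<le> t \<Longrightarrow> f (\<phi> s x) \<le> f (\<phi> t x)"
  by (rule DERIV_nonneg_imp_nondecreasing) (use f_derivative g_nonneg in blast)+

lemma zero_slope_at_rest_point:
  assumes "p \<in> rest_points"
  shows "p \<in> V" "g p = 0"
proof -
  have "\<phi> t p = p" for t using assms by (simp add: rest_points_def)
  then have "((\<lambda>t. f p) has_real_derivative g p) (at 0)"
    using f_derivative[of p 0] by simp
  then show "g p = 0" by (rule DERIV_unique) auto
  show "p \<in> V" using assms by (simp add: rest_points_def)
qed

lemma finite_rest_points: "finite rest_points"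
  using finite_subset[OF _ finite_zeros] zero_slope_at_rest_point by auto

text \<open>The slope vanishes along the open unit segment, so this connected segment lies in a
  finite set and is a single point. The group law then makes the whole orbit stationary.\<close>

lemma rest_point_if_f_constant:
  assumes V: "\<And>t. t \<in> {0..1} \<Longrightarrow> \<phi> t p \<in> V" and eq: "f (\<phi> 1 p) = f p"
  shows "p \<in> rest_points"
proof -
  have const: "f (\<phi> t p) = f p" if "t \<in> {0..1}" for t
    using f_flow_mono[of 0 t p] f_flow_mono[of t 1 p] that eq by (simp add: flow_zero)
  have zero: "g (\<phi> t p) = 0" if t: "t \<in> {0<..<1}" for t
  proof -
    have "((\<lambda>t. f p) has_real_derivative g (\<phi> t p)) (at t)"
      by (rule has_field_derivative_transform_within_open[OF f_derivative open_greaterThanLessThan t])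
        (use const in auto)
    then show ?thesis by (rule DERIV_unique) auto
  qed
  have "connected ((\<lambda>t. \<phi> t p) ` {0<..<1})"
    by (intro connected_continuous_image continuous_intros) auto
  moreover have "(\<lambda>t. \<phi> t p) ` {0<..<1} \<subseteq> {x \<in> V. g x = 0}"
    using zero V by auto
  then have "finite ((\<lambda>t. \<phi> t p) ` {0<..<1})"
    by (rule finite_subset[OF _ finite_zeros])
  moreover define q where "q = \<phi> (1 / 2) p"
  have "q \<in> (\<lambda>t. \<phi> t p) ` {0<..<1}" by (auto simp: q_def)
  ultimately have "(\<lambda>t. \<phi> t p) ` {0<..<1} - {q} = {}"
    using connected_closedD[of "(\<lambda>t. \<phi> t p) ` {0<..<1}" "{q}" "(\<lambda>t. \<phi> t p) ` {0<..<1} - {q}"]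
    by (auto simp: finite_imp_closed)
  then have q: "\<phi> t p = q" if "t \<in> {0<..<1}" for t
    using that by blast
  have "closed {t. \<phi> t p = q}"
    by (intro closed_Collect_eq continuous_intros)
  \<comment> \<open>Constancy so far holds on the open interval; closedness of the set of such times
    adds the endpoints and identifies \<open>q\<close> with \<open>p\<close>.\<close>
  then have "closure {0<..<1} \<subseteq> {t. \<phi> t p = q}"
    by (intro closure_minimal) (use q in auto)
  then have q: "\<phi> t p = q" if "t \<in> {0..1}" for t using that by auto
  then have qp: "q = p" by (metis atLeastAtMost_iff flow_zero order_refl zero_le_one)
  have nonneg: "\<phi> t p = p" if "0 \<le> t" for t
  proof -
    have "\<phi> (real n) p = p" for n
    proof (induction n)
      case (Suc n)
      have "\<phi> (1 + real n) p = \<phi> 1 (\<phi> (real n) p)" by (rule flow_plus)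
      with Suc q[of 1] qp show ?case by simp
    qed (simp add: flow_zero)
    moreover obtain n where "t - real n \<in> {0..1}"
    proof
      show "t - real (nat \<lfloor>t\<rfloor>) \<in> {0..1}" using \<open>0 \<le> t\<close> by (simp; linarith)
    qed
    moreover have "\<phi> (t - real n + real n) p = \<phi> (t - real n) (\<phi> (real n) p)"
      by (rule flow_plus)
    ultimately show ?thesis using q[of "t - real n"] qp by simp
  qed
  have "\<phi> t p = p" for t
  proof (cases "0 \<le> t")
    case False
    then have "\<phi> (t + - t) p = \<phi> t p" using nonneg[of "- t"] by (simp only: flow_plus)
    then show ?thesis by (simp add: flow_zero)
  qed (rule nonneg)
  with V[of 0] show ?thesis by (simp add: rest_points_def)
qed

text \<open>The compactness argument: if \<open>f\<close> gained arbitrarily little along unit time segments, the mean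
  value theorem would produce points on them with small slope, and the Palais-Smale condition a limit
  segment along which \<open>f\<close> is constant.\<close>

lemma uniform_gain:
  assumes C: "closed C" "C \<inter> rest_points = {}"
  shows "\<exists>\<delta>>0. \<forall>p\<in>C. (\<forall>t\<in>{0..1}. \<phi> t p \<in> V) \<longrightarrow> f p + \<delta> \<le> f (\<phi> 1 p)"
proof (rule ccontr)
  assume contra: "\<not> ?thesis"
  have "\<exists>p s. p \<in> C \<and> (\<forall>t\<in>{0..1}. \<phi> t p \<in> V) \<and> f (\<phi> 1 p) < f p + 1 / real (Suc n) \<and>
      s \<in> {0..1} \<and> g (\<phi> s p) < 1 / real (Suc n)" for n
  proof -
    have "1 / real (Suc n) > 0" by simp
    with contra obtain p where p: "p \<in> C" "\<forall>t\<in>{0..1}. \<phi> t p \<in> V"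
      "f (\<phi> 1 p) < f p + 1 / real (Suc n)"
      by (meson not_less)
    obtain s where "0 < s" "s < 1" "f (\<phi> 1 p) - f (\<phi> 0 p) = (1 - 0) * g (\<phi> s p)"
      using MVT2[of 0 1 "\<lambda>t. f (\<phi> t p)" "\<lambda>t. g (\<phi> t p)"] f_derivative by auto
    with p show ?thesis
      by (intro exI[of _ p] exI[of _ s]) (auto simp: flow_zero)
  qed
  then obtain p s where ps: "\<And>n. p n \<in> C" "\<And>n t. t \<in> {0..1} \<Longrightarrow> \<phi> t (p n) \<in> V"
    "\<And>n. f (\<phi> 1 (p n)) < f (p n) + 1 / real (Suc n)" "\<And>n. s n \<in> {0..1}"
    "\<And>n. g (\<phi> (s n) (p n)) < 1 / real (Suc n)"
    by metis
  have "(\<lambda>n. g (\<phi> (s n) (p n))) \<longlonglongrightarrow> 0"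
    by (rule real_tendsto_sandwich[OF _ _ tendsto_const LIMSEQ_Suc[OF lim_1_over_n]])
      (use g_nonneg ps(5) in \<open>auto intro!: always_eventually less_imp_le\<close>)
  moreover have "range (\<lambda>n. \<phi> (s n) (p n)) \<subseteq> V"
    using ps(2,4) by blast
  ultimately obtain l r where r: "strict_mono r" "(\<lambda>n. \<phi> (s (r n)) (p (r n))) \<longlonglongrightarrow> l"
    using palais_smale_g[of "\<lambda>n. \<phi> (s n) (p n)"] unfolding o_def by blast
  obtain u r' where r': "u \<in> {0..1}" "strict_mono r'" "((s \<circ> r) \<circ> r') \<longlonglongrightarrow> u"
    using compact_Icc[of "0::real" 1] ps(4) unfolding compact_def by (metis comp_apply)
  \<comment> \<open>The Palais-Smale condition gives convergence only of the points of small slope.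
    Flowing them back by the convergent times \<open>s\<close> gives convergence of the starting
    points.\<close>
  have "(\<lambda>n. \<phi> (- s (r (r' n))) (\<phi> (s (r (r' n))) (p (r (r' n))))) \<longlonglongrightarrow> \<phi> (- u) l"
    by (rule tendsto_flow[OF tendsto_minus])
      (use r' LIMSEQ_subseq_LIMSEQ[OF r(2) r'(2)] in \<open>auto simp: o_def\<close>)
  then have lim: "(\<lambda>n. p (r (r' n))) \<longlonglongrightarrow> \<phi> (- u) l"
    by (simp flip: flow_plus add: flow_zero)
  define q where "q = \<phi> (- u) l"
  note lim = lim[folded q_def]
  have "q \<in> C"
    using closed_sequentially[OF C(1) _ lim] ps(1) by blast
  moreover have "\<phi> t q \<in> V" if "t \<in> {0..1}" for t
    using closed_sequentially[OF closed_V _ tendsto_flow[OF tendsto_const lim]] ps(2)[OF that] by blast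
  moreover have "f (\<phi> 1 q) \<le> f q"
  proof (rule LIMSEQ_le)
    show "(\<lambda>n. f (\<phi> 1 (p (r (r' n))))) \<longlonglongrightarrow> f (\<phi> 1 q)"
      by (intro tendsto_f tendsto_flow lim tendsto_const)
    have "(\<lambda>n. 1 / real (Suc (r (r' n)))) \<longlonglongrightarrow> 0"
      using LIMSEQ_subseq_LIMSEQ[OF LIMSEQ_Suc[OF lim_1_over_n] strict_mono_o[OF r(1) r'(2)]]
      by (simp add: o_def)
    from tendsto_add[OF tendsto_f[OF lim] this]
    show "(\<lambda>n. f (p (r (r' n))) + 1 / real (Suc (r (r' n)))) \<longlonglongrightarrow> f q" by simp
  qed (use ps(3) less_imp_le in blast)
  then have "f (\<phi> 1 q) = f q"
    using f_flow_mono[of 0 1 q] by (simp add: flow_zero)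
  ultimately have "q \<in> C \<inter> rest_points"
    using rest_point_if_f_constant by blast
  then show False using C(2) by blast
qed

text \<open>The set \<open>C\<close> where all bump functions are at most 1/2 is closed and misses
  the rest points, so each unit step from \<open>C\<close> gains \<open>\<delta>\<close>. The
  threshold lies strictly between the value 1 at the rest point and the value 0 later attached to
  \<open>[L]\<close>.\<close>

lemma hitting_time_bound:
  assumes \<rho>: "\<And>r. r \<in> rest_points \<Longrightarrow> continuous_on UNIV (\<rho> r :: 'a \<Rightarrow> real) \<and> \<rho> r r = 1"
  obtains m :: nat where
    "\<forall>x. (\<forall>t\<in>{0..real m}. \<phi> t x \<in> V) \<longrightarrow> (\<exists>n<m. \<exists>r\<in>rest_points. \<rho> r (\<phi> (real n) x) > 1 / 2)"
proof -
  define C where "C = (\<Inter>r\<in>rest_points. {x. \<rho> r x \<le> 1 / 2})"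
  have "closed C" unfolding C_def
    by (intro closed_INT ballI closed_Collect_le continuous_on_const) (use \<rho> in auto)
  moreover have "C \<inter> rest_points = {}"
    using \<rho> by (fastforce simp: C_def)
  ultimately obtain \<delta> where \<delta>: "\<delta> > 0"
    "\<forall>p\<in>C. (\<forall>t\<in>{0..1}. \<phi> t p \<in> V) \<longrightarrow> f p + \<delta> \<le> f (\<phi> 1 p)"
    using uniform_gain by meson
  obtain D where D: "\<And>x. x \<in> V \<Longrightarrow> \<bar>f x\<bar> \<le> D"
    using bounded_V unfolding bounded_iff by auto
  \<comment> \<open>\<open>2 * D\<close> bounds the oscillation of \<open>f\<close> on
    \<open>V\<close>; \<open>m\<close> gains of \<open>\<delta>\<close> exceed it.\<close>
  obtain m :: nat where m: "2 * D < real m * \<delta>"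
    using \<delta>(1) reals_Archimedean3 by blast
  show thesis
  proof (rule that[of m], intro allI impI, rule ccontr)
    fix x assume "\<forall>t\<in>{0..real m}. \<phi> t x \<in> V"
    then have V: "\<phi> t x \<in> V" if "t \<in> {0..real m}" for t
      using that by blast
    assume no: "\<not> (\<exists>n<m. \<exists>r\<in>rest_points. \<rho> r (\<phi> (real n) x) > 1 / 2)"
    have "f x + real n * \<delta> \<le> f (\<phi> (real n) x)" if "n \<le> m" for n
      using that
    proof (induction n)
      case (Suc n)
      have step: "\<phi> (t + real n) x = \<phi> t (\<phi> (real n) x)" for t by (rule flow_plus)
      have "f (\<phi> (real n) x) + \<delta> \<le> f (\<phi> 1 (\<phi> (real n) x))"
      proof (rule \<delta>(2)[rule_format])
        have "\<rho> r (\<phi> (real n) x) \<le> 1 / 2" if "r \<in> rest_points" for r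
          using no that Suc_le_lessD[OF Suc.prems] not_less by blast
        then show "\<phi> (real n) x \<in> C" by (simp add: C_def)
        show "\<phi> t (\<phi> (real n) x) \<in> V" if "t \<in> {0..1}" for t
          using V[of "t + real n"] that Suc.prems by (auto simp: step)
      qed
      with Suc step[of 1] show ?case by (simp add: algebra_simps)
    qed (simp add: flow_zero)
    from this[of m] D[OF V[of 0]] D[OF V[of "real m"]] m show False
      by (simp add: flow_zero abs_le_iff)
  qed
qed

text \<open>Between two visits to \<open>B\<close> the orbit may leave \<open>B\<close>, hence the
  larger set \<open>B'\<close>. Only segments inside \<open>V\<close> count, because the uniform
  gain is available only there.\<close>

definition no_return :: "'a set \<Rightarrow> 'a set \<Rightarrow> bool" where
  "no_return B B' \<longleftrightarrow> (\<forall>x\<in>B. \<forall>b. \<phi> b x \<in> B \<longrightarrow> (\<forall>t\<in>{0..b}. \<phi> t x \<in> V) \<longrightarrow> (\<forall>s\<in>{0..b}. \<phi> s x \<in> B'))"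

text \<open>A segment that left \<open>B'\<close> and came back close to \<open>r\<close> would cross the frontier of \<open>B'\<close>, where it
  picks up a definite gain of \<open>f\<close>, although \<open>f\<close> is almost equal to \<open>f r\<close> at both its ends.\<close>

lemma no_return_nbhd:
  assumes r: "r \<in> rest_points" and G: "open G" "r \<in> G"
  obtains B B' where "open B" "r \<in> B" "B' \<subseteq> G"
    "homotopic_with_canon (\<lambda>_. True) B' B' id (\<lambda>_. r)"
    "no_return B B'"
proof -
  have rest: "\<phi> t r = r" for t using r by (simp add: rest_points_def)
  \<comment> \<open>Removing the other rest points keeps them off the frontier of
    \<open>B'\<close>.\<close>
  define G' where "G' = G - (rest_points - {r})"
  have "closed (rest_points - {r})"
    using finite_rest_points by (intro finite_imp_closed) auto
  then have G': "open G'" "r \<in> G'"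
    using G by (auto simp: G'_def)
  obtain W where W: "open W" "r \<in> W" "closure W \<subseteq> G'"
    using open_closure_subset_nbhd[OF G'] .
  obtain B' where B': "open B'" "r \<in> B'" "B' \<subseteq> W" "homotopic_with_canon (\<lambda>_. True) B' B' id (\<lambda>_. r)"
    using contractible_nbhd[OF W(1,2)] by blast
  have "frontier B' \<subseteq> closure W - B'"
    using closure_mono[OF B'(3)] B'(1) by (auto simp: frontier_def interior_open)
  then have "frontier B' \<inter> rest_points = {}"
    using W(3) B'(2) by (auto simp: G'_def)
  then obtain \<delta> where \<delta>: "\<delta> > 0"
    "\<forall>p\<in>frontier B'. (\<forall>t\<in>{0..1}. \<phi> t p \<in> V) \<longrightarrow> f p + \<delta> \<le> f (\<phi> 1 p)"
    using uniform_gain[OF frontier_closed] by meson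
  \<comment> \<open>The tube around \<open>{r} \<times> {-1..0}\<close> yields points whose past
    unit of orbit lies in \<open>B'\<close>. A frontier crossing then happens at least one unit
    before the return, leaving room for a full unit of gain.\<close>
  have "open ((\<lambda>(x, t). \<phi> t x) -` B')"
    by (rule open_vimage[OF B'(1)]) (auto simp: case_prod_beta intro!: continuous_intros)
  moreover have "{r} \<times> {-1..0} \<subseteq> (\<lambda>(x, t). \<phi> t x) -` B'"
    using rest B'(2) by auto
  ultimately obtain T where T: "r \<in> T" "open T" "T \<times> {-1..0} \<subseteq> (\<lambda>(x, t). \<phi> t x) -` B'"
    using Elementary_Topology.tube_lemma[of "{-1..0}" "(\<lambda>(x, t). \<phi> t x) -` B'" r] compact_Icc by blast
  \<comment> \<open>With radius \<open>\<delta> / 2\<close>, values of \<open>f\<close> at two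
    points of \<open>B\<close> differ by less than \<open>\<delta>\<close>.\<close>
  define B where "B = T \<inter> f -` ball (f r) (\<delta> / 2)"
  have "open B" unfolding B_def
    by (intro open_Int T open_vimage f_continuous open_ball)
  moreover have "r \<in> B" using T(1) \<delta>(1) by (simp add: B_def)
  moreover have "\<phi> s x \<in> B'" if x: "x \<in> B" "\<phi> b x \<in> B" and V: "\<And>t. t \<in> {0..b} \<Longrightarrow> \<phi> t x \<in> V"
    and s: "s \<in> {0..b}" for x b s
  proof (rule ccontr)
    assume out: "\<phi> s x \<notin> B'"
    have near: "\<phi> u y \<in> B'" if "y \<in> B" "u \<in> {-1..0}" for y u
    proof -
      have "(y, u) \<in> T \<times> {-1..0}" using that by (simp add: B_def)
      from subsetD[OF T(3) this] show ?thesis by simp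
    qed
    have "x \<in> B'" using near[OF x(1), of 0] by (simp add: flow_zero)
    moreover have "connected ((\<lambda>t. \<phi> t x) ` {0..s})"
      by (intro connected_continuous_image continuous_intros) auto
    moreover have "\<phi> 0 x \<in> (\<lambda>t. \<phi> t x) ` {0..s}" "\<phi> s x \<in> (\<lambda>t. \<phi> t x) ` {0..s}"
      using s by (auto intro!: imageI)
    ultimately have "(\<lambda>t. \<phi> t x) ` {0..s} \<inter> frontier B' \<noteq> {}"
      using out by (intro connected_Int_frontier) (auto simp: flow_zero)
    then obtain v where v: "v \<in> {0..s}" "\<phi> v x \<in> frontier B'" by blast
    then have notin: "\<phi> v x \<notin> B'" using B'(1) by (auto simp: frontier_def interior_open)
    have "v + 1 \<le> b"
    proof (rule ccontr)
      assume "\<not> v + 1 \<le> b"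
      then have "v - b \<in> {-1..0}" using v s by auto
      from near[OF x(2) this] notin show False by (simp flip: flow_plus)
    qed
    have "f (\<phi> v x) + \<delta> \<le> f (\<phi> 1 (\<phi> v x))"
    proof (rule \<delta>(2)[rule_format, OF v(2)])
      show "\<phi> t (\<phi> v x) \<in> V" if "t \<in> {0..1}" for t
        using V[of "t + v"] that v(1) \<open>v + 1 \<le> b\<close> by (auto simp: flow_plus)
    qed
    moreover have "f (\<phi> 1 (\<phi> v x)) \<le> f (\<phi> b x)"
      using f_flow_mono[of "1 + v" b x] \<open>v + 1 \<le> b\<close> by (simp add: flow_plus)
    moreover have "f x \<le> f (\<phi> v x)"
      using f_flow_mono[of 0 v x] v(1) by (simp add: flow_zero)
    ultimately show False
      using x by (auto simp: B_def dist_real_def abs_if split: if_splits)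
  qed
  moreover have "B' \<subseteq> G" using B'(3) W(3) closure_subset by (fastforce simp: G'_def)
  ultimately show thesis using B'(4) by (intro that[of B B']) (auto simp: no_return_def)
qed

end

section \<open>Quotient spaces and relative category\<close>

lemma openin_quotient_space_Some:
  assumes "S \<subseteq> N - L"
  shows "openin (quotient_space N L) (Some ` S) \<longleftrightarrow> openin (top_of_set N) S"
proof -
  have "{x \<in> N. collapse L x \<in> Some ` S} = S"
    using assms by (auto simp: collapse_def split: if_splits)
  then show ?thesis using assms by (auto simp: openin_quotient_space)
qed

lemma continuous_map_collapse:
  assumes "L \<subseteq> N"
  shows "continuous_map (top_of_set N) (quotient_space N L) (collapse L)"
  unfolding continuous_map_def
  by (auto simp: openin_quotient_space topspace_quotient_space[OF assms] collapse_def)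

text \<open>The universal property of the quotient.\<close>

lemma continuous_map_from_quotient_space:
  assumes "L \<subseteq> N" "continuous_on N (\<lambda>x. h (collapse L x))"
  shows "continuous_map (quotient_space N L) euclidean h"
  unfolding continuous_map_def
proof (intro conjI allI impI)
  fix T :: "'b set" assume "openin euclidean T"
  then have "openin (top_of_set N) (N \<inter> (\<lambda>x. h (collapse L x)) -` T)"
    using assms(2) continuous_openin_preimage_gen by auto
  also have "N \<inter> (\<lambda>x. h (collapse L x)) -` T =
      {x \<in> N. collapse L x \<in> {z \<in> topspace (quotient_space N L). h z \<in> T}}"
    by (auto simp: topspace_quotient_space[OF assms(1)] collapse_def)
  finally show "openin (quotient_space N L) {z \<in> topspace (quotient_space N L). h z \<in> T}"
    unfolding openin_quotient_space by (auto simp: topspace_quotient_space[OF assms(1)])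
qed simp

lemma continuous_map_Some_quotient_space:
  assumes "L \<subseteq> N"
  shows "continuous_map (top_of_set (N - L)) (quotient_space N L) Some"
proof (rule continuous_map_eq)
  show "continuous_map (top_of_set (N - L)) (quotient_space N L) (collapse L)"
    using continuous_map_from_subtopology[OF continuous_map_collapse[OF assms], of "N - L"]
    by (simp add: subtopology_subtopology Int_absorb1)
qed (auto simp: collapse_def)

text \<open>Closedness of \<open>L\<close> makes \<open>N - L\<close> open in \<open>N\<close>, so
  its open subsets have open images under \<open>Some\<close>. With
  \<open>continuous_map_Some_quotient_space\<close> this identifies \<open>N - L\<close> with the
  quotient off its base point.\<close>

lemma continuous_map_the_quotient_space:
  assumes "closed L" "L \<subseteq> N"
  shows "continuous_map (subtopology (quotient_space N L) (Some ` (N - L))) (top_of_set (N - L)) the"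
  unfolding continuous_map_def
proof (intro conjI allI impI)
  let ?Z = "subtopology (quotient_space N L) (Some ` (N - L))"
  have top: "topspace ?Z = Some ` (N - L)"
    by (auto simp: topspace_quotient_space[OF assms(2)])
  show "the \<in> topspace ?Z \<rightarrow> topspace (top_of_set (N - L))"
    using top by auto
  have NL: "openin (top_of_set N) (N - L)"
    using openin_open_Int[OF open_Compl[OF assms(1)], of N] by (simp add: Diff_eq)
  fix S assume "openin (top_of_set (N - L)) S"
  then have S: "openin (top_of_set N) S" "S \<subseteq> N - L"
    using openin_trans[OF _ NL] openin_subset by fastforce+
  have "openin ?Z (Some ` S)"
    using S by (auto simp: openin_subtopology openin_quotient_space_Some intro!: exI[of _ "Some ` S"])
  also have "Some ` S = {z \<in> topspace ?Z. the z \<in> S}"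
    using S(2) unfolding top by auto
  finally show "openin ?Z {z \<in> topspace ?Z. the z \<in> S}" .
qed

text \<open>Conjugates the homotopy by \<open>Some\<close> and \<open>the\<close>. Contractible sets
  are thus built once, in \<open>N\<close>, and serve both inequalities.\<close>

lemma contractible_in_quotient_space:
  assumes L: "closed L" "L \<subseteq> N" and W: "W \<subseteq> N - L"
    and c: "contractible_in (top_of_set N) W (N - L)"
  shows "contractible_in (quotient_space N L) (Some ` W) (topspace (quotient_space N L) - {None})"
proof -
  let ?Z = "quotient_space N L"
  have top: "topspace ?Z - {None} = Some ` (N - L)"
    by (auto simp: topspace_quotient_space[OF L(2)])
  have sub: "subtopology (top_of_set N) W = top_of_set W" "subtopology (top_of_set N) (N - L) = top_of_set (N - L)"
    using W by (auto simp: subtopology_subtopology intro!: arg_cong[of _ _ "subtopology euclidean"])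
  obtain a where "homotopic_with (\<lambda>_. True) (top_of_set W) (top_of_set (N - L)) id (\<lambda>_. a)"
    using c unfolding contractible_in_def sub by blast
  moreover have "continuous_map (top_of_set (N - L)) (subtopology ?Z (Some ` (N - L))) Some"
    by (intro continuous_map_into_subtopology continuous_map_Some_quotient_space L) auto
  ultimately have "homotopic_with (\<lambda>_. True) (top_of_set W) (subtopology ?Z (Some ` (N - L)))
      (Some \<circ> id) (Some \<circ> (\<lambda>_. a))"
    by (rule homotopic_with_compose_continuous_map_left) simp
  moreover have "continuous_map (subtopology ?Z (Some ` W)) (top_of_set W) the"
  proof -
    have "continuous_map (subtopology ?Z (Some ` W)) (top_of_set (N - L)) the"
      using continuous_map_the_quotient_space[OF L] continuous_map_from_subtopology_mono W
      by (metis image_mono)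
    then show ?thesis
      by (auto simp: continuous_map_in_subtopology)
  qed
  ultimately have "homotopic_with (\<lambda>_. True) (subtopology ?Z (Some ` W)) (subtopology ?Z (Some ` (N - L)))
      (Some \<circ> id \<circ> the) (Some \<circ> (\<lambda>_. a) \<circ> the)"
    by (rule homotopic_with_compose_continuous_map_right) simp
  then have "homotopic_with (\<lambda>_. True) (subtopology ?Z (Some ` W)) (subtopology ?Z (Some ` (N - L)))
      id (\<lambda>_. Some a)"
    by (rule homotopic_with_eq) auto
  then show ?thesis unfolding contractible_in_def top by blast
qed

lemma relative_category_le_card:
  assumes fin: "finite R"
    and U: "openin Z U" "deformation_retract_in Z A U"
    and W: "\<And>r. r \<in> R \<Longrightarrow> openin Z (W r)" "\<And>r. r \<in> R \<Longrightarrow> W r \<subseteq> topspace Z - A"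
      "\<And>r. r \<in> R \<Longrightarrow> contractible_in Z (W r) (topspace Z - A)"
    and cover: "topspace Z \<subseteq> U \<union> (\<Union>r\<in>R. W r)"
  shows "relative_category Z A \<le> enat (card R)"
proof -
  \<comment> \<open>The enumeration starts at 1 because index 0 is reserved for the set that
    retracts onto \<open>A\<close>.\<close>
  obtain e where e: "bij_betw e {1..card R} R"
    using ex_bij_betw_nat_finite_1[OF fin] by blast
  have eR: "e i \<in> R" if "i \<in> {1..card R}" for i
    using e that by (auto simp: bij_betw_def)
  define T where "T i = (if i = 0 then U else W (e i))" for i :: nat
  have "R = e ` {1..card R}" using e by (simp add: bij_betw_def)
  then have "(\<Union>r\<in>R. W r) = (\<Union>i\<in>{1..card R}. W (e i))"
    by (metis image_image)
  then have "topspace Z \<subseteq> U \<union> (\<Union>i\<in>{1..card R}. W (e i))"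
    using cover by simp
  also have "\<dots> \<subseteq> (\<Union>i\<le>card R. T i)" by (fastforce simp: T_def)
  finally have "topspace Z \<subseteq> (\<Union>i\<le>card R. T i)" .
  moreover have op: "openin Z (T i)" if "i \<le> card R" for i
    using U W eR that by (auto simp: T_def)
  ultimately have "(\<Union>i\<le>card R. T i) = topspace Z"
    using openin_subset by fast
  moreover have "T i \<subseteq> topspace Z - A \<and> contractible_in Z (T i) (topspace Z - A)"
    if "i \<in> {1..card R}" for i
    using W eR[OF that] that by (auto simp: T_def)
  moreover have "deformation_retract_in Z A (T 0)" using U by (simp add: T_def)
  ultimately show ?thesis
    unfolding relative_category_def using op by (intro Inf_lower) blast
qed

text \<open>The first and the last index of positive weight bracket the mean; the indices outside
  contribute nothing to either sum.\<close>

lemma weighted_mean_between: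
  fixes k :: "nat \<Rightarrow> real"
  assumes k: "\<And>n. 0 \<le> k n" and pos: "\<exists>n<m. 0 < k n"
  obtains a b where "a < m" "b < m" "0 < k a" "0 < k b" "a \<le> b"
    "real a \<le> (\<Sum>n<m. real n * k n) / (\<Sum>n<m. k n)" "(\<Sum>n<m. real n * k n) / (\<Sum>n<m. k n) \<le> real b"
proof -
  define J where "J = {n. n < m \<and> 0 < k n}"
  have J: "finite J" "J \<noteq> {}" using pos by (auto simp: J_def)
  have in_J: "n \<in> J \<or> k n = 0" if "n < m" for n
    using that k[of n] by (auto simp: J_def)
  have S: "0 < (\<Sum>n<m. k n)"
    using pos k by (auto intro!: sum_pos2)
  have 1: "real (Min J) * (\<Sum>n<m. k n) \<le> (\<Sum>n<m. real n * k n)"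
    unfolding sum_distrib_left
  proof (rule sum_mono)
    fix n assume "n \<in> {..<m}"
    then consider "n \<in> J" | "k n = 0" using in_J by blast
    then show "real (Min J) * k n \<le> real n * k n"
      by cases (use Min_le[OF J(1), of n] k in \<open>auto intro!: mult_right_mono\<close>)
  qed
  have 2: "(\<Sum>n<m. real n * k n) \<le> real (Max J) * (\<Sum>n<m. k n)"
    unfolding sum_distrib_left
  proof (rule sum_mono)
    fix n assume "n \<in> {..<m}"
    then consider "n \<in> J" | "k n = 0" using in_J by blast
    then show "real n * k n \<le> real (Max J) * k n"
      by cases (use Max_ge[OF J(1), of n] k in \<open>auto intro!: mult_right_mono\<close>)
  qed
  have mem: "Min J \<in> J" "Max J \<in> J" "Min J \<le> Max J"
    using J by auto
  then have "Min J < m" "Max J < m" "0 < k (Min J)" "0 < k (Max J)"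
    unfolding J_def by blast+
  then show thesis
    using 1 2 S mem by (intro that[of "Min J" "Max J"]) (simp_all add: field_simps)
qed


section \<open>Gradient-like flows near an index pair\<close>

locale gradient_like_index_pair = gradient_like_flow \<phi> f g V
  for \<phi> :: "real \<Rightarrow> 'a::t3_space \<Rightarrow> 'a" and f g V +
  fixes N L :: "'a set"
  assumes V_eq: "V = closure (N - L)"
    and index_pair: "index_pair \<phi> N L"
begin

abbreviation Z :: "'a option topology" where
  "Z \<equiv> quotient_space N L"

abbreviation \<Phi> :: "real \<Rightarrow> 'a option \<Rightarrow> 'a option" where
  "\<Phi> \<equiv> induced_semiflow \<phi> N L"

lemma closed_pair: "closed N" "closed L" "L \<subseteq> N"
  using index_pair by (auto simp: index_pair_def)

lemma NL_subset_V: "N - L \<subseteq> V"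
  unfolding V_eq by (rule closure_subset)

lemma topspace_Z: "topspace Z = insert None (Some ` (N - L))"
  by (rule topspace_quotient_space[OF closed_pair(3)])

lemma openin_NL: "openin (top_of_set N) (N - L)"
  using openin_open_Int[OF open_Compl[OF closed_pair(2)], of N] by (simp add: Diff_eq)

lemma interior_V_subset: "interior V - L \<subseteq> N - L"
proof -
  have "V \<subseteq> N" unfolding V_eq using closed_pair(1) by (intro closure_minimal) auto
  then show ?thesis using interior_subset by blast
qed

text \<open>\<open>{r}\<close> is itself invariant, so it lies in the maximal invariant set of
  \<open>V\<close>, which an index pair keeps inside \<open>interior V\<close> and off
  \<open>L\<close>.\<close>

lemma rest_point_in_interior:
  assumes "r \<in> rest_points"
  shows "r \<in> interior V - L"
proof -
  obtain I where I: "isolating_neighborhood \<phi> V I" "I \<subseteq> N - L"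
    using index_pair unfolding index_pair_def V_eq by blast
  have "invariant_set \<phi> {r}" "{r} \<subseteq> V"
    using assms by (auto simp: rest_points_def invariant_set_def)
  then have "r \<in> I" using I(1) unfolding isolating_neighborhood_def by blast
  with I show ?thesis unfolding isolating_neighborhood_def by blast
qed

lemma \<Phi>_None [simp]: "\<Phi> t None = None"
  by (simp add: induced_semiflow_def)

lemma \<Phi>_Some: "\<Phi> t (Some x) = (if \<forall>s\<in>{0..t}. \<phi> s x \<in> N - L then Some (\<phi> t x) else None)"
  by (simp add: induced_semiflow_def)

lemma \<Phi>_add:
  assumes "0 \<le> s" "0 \<le> t"
  shows "\<Phi> (s + t) z = \<Phi> s (\<Phi> t z)"
proof (cases z)
  case (Some x)
  have "(\<forall>u\<in>{0..s + t}. \<phi> u x \<in> N - L) \<longleftrightarrow>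
      (\<forall>u\<in>{0..t}. \<phi> u x \<in> N - L) \<and> (\<forall>u\<in>{0..s}. \<phi> (u + t) x \<in> N - L)"
    (is "?l \<longleftrightarrow> ?r")
  proof
    assume ?l with assms show ?r by auto
  next
    assume r: ?r
    show ?l
    proof
      fix u assume u: "u \<in> {0..s + t}"
      show "\<phi> u x \<in> N - L"
      proof (cases "u \<le> t")
        case False
        then have "u - t \<in> {0..s}" using u by auto
        with r have "\<phi> (u - t + t) x \<in> N - L" by blast
        then show ?thesis by simp
      qed (use r u in auto)
    qed
  qed
  then show ?thesis by (auto simp: Some \<Phi>_Some flow_plus)
qed simp

lemma continuous_map_semiflow:
  "continuous_map (prod_topology Z (top_of_set {0..})) Z (\<lambda>(z, t). \<Phi> t z)"
  using index_pair by (simp add: index_pair_def)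

lemma continuous_map_\<Phi>:
  assumes "0 \<le> t"
  shows "continuous_map Z Z (\<Phi> t)"
proof -
  have "continuous_map Z (prod_topology Z (top_of_set {0..})) (\<lambda>z. (z, t))"
    using assms by (intro continuous_map_pairedI) auto
  from continuous_map_compose[OF this continuous_map_semiflow] show ?thesis
    by (simp add: o_def)
qed

lemma \<Phi>_in_Z: "0 \<le> t \<Longrightarrow> z \<in> topspace Z \<Longrightarrow> \<Phi> t z \<in> topspace Z"
  using continuous_map_\<Phi> continuous_map_image_subset_topspace by fast

lemma \<Phi>_zero: "z \<in> topspace Z \<Longrightarrow> \<Phi> 0 z = z"
  by (auto simp: topspace_Z \<Phi>_Some flow_zero)

text \<open>The value 0 at \<open>None\<close> lets a function that vanishes on \<open>L\<close>
  descend continuously to the quotient.\<close>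

definition collapsed :: "('a \<Rightarrow> real) \<Rightarrow> 'a option \<Rightarrow> real" where
  "collapsed \<rho> z = (case z of None \<Rightarrow> 0 | Some x \<Rightarrow> \<rho> x)"

lemma continuous_map_collapsed:
  assumes "continuous_on UNIV \<rho>" "\<And>x. x \<in> L \<Longrightarrow> \<rho> x = 0"
  shows "continuous_map Z euclidean (collapsed \<rho>)"
proof (rule continuous_map_from_quotient_space[OF closed_pair(3)])
  have "collapsed \<rho> (collapse L x) = \<rho> x" for x
    using assms(2) by (simp add: collapsed_def collapse_def)
  then show "continuous_on N (\<lambda>x. collapsed \<rho> (collapse L x))"
    by (simp add: continuous_on_subset[OF assms(1)])
qed

text \<open>Sampling through \<open>\<Phi>\<close> makes the weights continuous in \<open>x\<close>
  even where orbits leave \<open>N - L\<close>, and a positive weight at \<open>n\<close> certifies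
  that the orbit has stayed in \<open>N - L\<close> up to time \<open>n\<close>.\<close>

definition visiting_set :: "nat \<Rightarrow> ('a \<Rightarrow> real) \<Rightarrow> 'a set" where
  "visiting_set m \<rho> = {x \<in> N - L. \<exists>n<m. 0 < collapsed \<rho> (\<Phi> (real n) (Some x))}"

lemma continuous_on_collapsed_\<Phi>:
  assumes "continuous_on UNIV \<rho>" "\<And>x. x \<in> L \<Longrightarrow> \<rho> x = 0" "0 \<le> t"
  shows "continuous_on (N - L) (\<lambda>x. collapsed \<rho> (\<Phi> t (Some x)))"
  using continuous_map_compose[OF continuous_map_compose[OF
      continuous_map_Some_quotient_space[OF closed_pair(3)] continuous_map_\<Phi>[OF assms(3)]]
      continuous_map_collapsed[OF assms(1,2)]]
  by (simp add: o_def)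

lemma openin_visiting_set:
  assumes "continuous_on UNIV \<rho>" "\<And>x. x \<in> L \<Longrightarrow> \<rho> x = 0"
  shows "openin (top_of_set N) (visiting_set m \<rho>)"
proof -
  have "openin (top_of_set (N - L)) ((N - L) \<inter> (\<lambda>x. collapsed \<rho> (\<Phi> (real n) (Some x))) -` {0<..})" for n
    by (rule continuous_openin_preimage_gen[OF continuous_on_collapsed_\<Phi>[OF assms]]) auto
  then have "openin (top_of_set (N - L))
      (\<Union>n<m. (N - L) \<inter> (\<lambda>x. collapsed \<rho> (\<Phi> (real n) (Some x))) -` {0<..})"
    by (intro openin_Union) blast
  moreover have "(\<Union>n<m. (N - L) \<inter> (\<lambda>x. collapsed \<rho> (\<Phi> (real n) (Some x))) -` {0<..}) =
      visiting_set m \<rho>"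
    by (auto simp: visiting_set_def)
  ultimately show ?thesis using openin_trans openin_NL by metis
qed

text \<open>The points of a visiting set are moved along the flow for a continuously varying time, namely a
  weighted mean of the integer times at which they are in \<open>B\<close>. At that mean time they need not be in
  \<open>B\<close> but they are in \<open>B'\<close>.\<close>

lemma contractible_visiting_set:
  assumes \<rho>: "continuous_on UNIV \<rho>" "\<And>x. 0 \<le> \<rho> x" "\<And>x. 0 < \<rho> x \<Longrightarrow> x \<in> B" "\<And>x. x \<in> L \<Longrightarrow> \<rho> x = 0"
    and B': "B' \<subseteq> N - L" "homotopic_with_canon (\<lambda>_. True) B' B' id (\<lambda>_. r)"
    and no_return: "no_return B B'"
  shows "contractible_in (top_of_set N) (visiting_set m \<rho>) (N - L)"
proof -
  define W where "W = visiting_set m \<rho>"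
  have WNL: "W \<subseteq> N - L" by (auto simp: W_def visiting_set_def)
  have sub: "subtopology (top_of_set N) W = top_of_set W" "subtopology (top_of_set N) (N - L) = top_of_set (N - L)"
    using WNL by (auto simp: subtopology_subtopology intro!: arg_cong[of _ _ "subtopology euclidean"])
  define k where "k x n = collapsed \<rho> (\<Phi> (real n) (Some x))" for x n
  define \<theta> where "\<theta> x = (\<Sum>n<m. real n * k x n) / (\<Sum>n<m. k x n)" for x
  have k_nonneg: "0 \<le> k x n" for x n
    using \<rho>(2) by (simp add: k_def collapsed_def split: option.split)
  have k_posD: "\<phi> (real n) x \<in> B \<and> (\<forall>t\<in>{0..real n}. \<phi> t x \<in> N - L)" if "0 < k x n" for x n
    using that \<rho>(3) by (auto simp: k_def collapsed_def \<Phi>_Some split: if_splits)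
  have k_pos: "\<exists>n<m. 0 < k x n" if "x \<in> W" for x
    using that by (auto simp: W_def visiting_set_def k_def)
  \<comment> \<open>\<open>a\<close> and \<open>b\<close> are visiting times around the mean. The
    no-return property, applied from \<open>\<phi> (real a) x\<close> on, puts the orbit in
    \<open>B'\<close> at the mean time; survival until \<open>b\<close> covers all earlier
    times.\<close>
  have path: "(\<forall>t\<in>{0..\<theta> x}. \<phi> t x \<in> N - L) \<and> \<phi> (\<theta> x) x \<in> B'" if x: "x \<in> W" for x
  proof -
    obtain a b where ab: "0 < k x a" "0 < k x b" "a \<le> b" "real a \<le> \<theta> x" "\<theta> x \<le> real b"
      using weighted_mean_between[of "k x" m, OF k_nonneg k_pos[OF x]] unfolding \<theta>_def by blast
    have "\<phi> (real a) x \<in> B" using k_posD[OF ab(1)] by blast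
    moreover have "\<phi> (real b - real a) (\<phi> (real a) x) \<in> B"
      using k_posD[OF ab(2)] by (simp flip: flow_plus)
    moreover have "\<phi> t (\<phi> (real a) x) \<in> V" if "t \<in> {0..real b - real a}" for t
    proof -
      have "t + real a \<in> {0..real b}" using that by auto
      then have "\<phi> (t + real a) x \<in> V" using k_posD[OF ab(2)] NL_subset_V by blast
      then show ?thesis by (simp add: flow_plus)
    qed
    moreover have "\<theta> x - real a \<in> {0..real b - real a}" using ab by auto
    ultimately have "\<phi> (\<theta> x - real a) (\<phi> (real a) x) \<in> B'"
      using no_return unfolding no_return_def by blast
    then have "\<phi> (\<theta> x) x \<in> B'" by (simp flip: flow_plus)
    moreover have "\<phi> t x \<in> N - L" if "t \<in> {0..\<theta> x}" for t
    proof -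
      have "t \<in> {0..real b}" using that ab(5) by auto
      then show ?thesis using k_posD[OF ab(2)] by blast
    qed
    ultimately show ?thesis by blast
  qed
  have \<theta>_nonneg: "0 \<le> \<theta> x" for x
    unfolding \<theta>_def by (intro divide_nonneg_nonneg sum_nonneg mult_nonneg_nonneg k_nonneg) auto
  have k_cont: "continuous_on W (\<lambda>x. k x n)" for n
    unfolding k_def by (rule continuous_on_subset[OF continuous_on_collapsed_\<Phi>[OF \<rho>(1,4)] WNL]) auto
  have "(\<Sum>n<m. k x n) \<noteq> 0" if "x \<in> W" for x
    using k_pos[OF that] k_nonneg sum_pos2[of "{..<m}" _ "k x"] by (metis finite_lessThan lessThan_iff order_less_irrefl)
  then have \<theta>_cont: "continuous_on W \<theta>"
    unfolding \<theta>_def by (intro continuous_intros k_cont) auto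
  have "homotopic_with_canon (\<lambda>_. True) W (N - L) id (\<lambda>x. \<phi> (\<theta> x) x)"
    unfolding homotopic_with_def
  proof (intro exI[of _ "\<lambda>(s, x). \<phi> (s * \<theta> x) x"] conjI allI ballI)
    have "continuous_on ({0..1} \<times> W) (\<lambda>(s, x). \<phi> (s * \<theta> x) x)"
      unfolding case_prod_beta
      by (intro continuous_intros continuous_on_compose2[OF \<theta>_cont]) auto
    moreover have "\<phi> (s * \<theta> x) x \<in> N - L" if "s \<in> {0..1}" "x \<in> W" for s x
    proof -
      have "s * \<theta> x \<in> {0..\<theta> x}"
        using that(1) \<theta>_nonneg[of x] by (auto intro: mult_left_le_one_le)
      then show ?thesis using path[OF that(2)] by blast
    qed
    ultimately show "continuous_map (prod_topology (top_of_set {0..1}) (top_of_set W)) (top_of_set (N - L))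
        (\<lambda>(s, x). \<phi> (s * \<theta> x) x)"
      by (auto simp flip: subtopology_Times euclidean_product_topology)
  qed (auto simp: flow_zero)
  \<comment> \<open>Second leg: once the flow has carried \<open>W\<close> into \<open>B'\<close>,
    the contraction of \<open>B'\<close> takes over.\<close>
  moreover have "homotopic_with_canon (\<lambda>_. True) W (N - L) (id \<circ> (\<lambda>x. \<phi> (\<theta> x) x)) ((\<lambda>_. r) \<circ> (\<lambda>x. \<phi> (\<theta> x) x))"
  proof (rule homotopic_with_compose_continuous_map_right)
    show "homotopic_with_canon (\<lambda>_. True) B' (N - L) id (\<lambda>_. r)"
      by (rule homotopic_with_subset_right[OF B'(2,1)])
    show "continuous_map (top_of_set W) (top_of_set B') (\<lambda>x. \<phi> (\<theta> x) x)"
      using path by (auto intro!: continuous_intros \<theta>_cont)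
  qed simp
  ultimately have "homotopic_with_canon (\<lambda>_. True) W (N - L) id (\<lambda>_. r)"
    by (auto simp: o_def intro: homotopic_with_trans)
  then show ?thesis
    unfolding contractible_in_def W_def[symmetric] sub by blast
qed

text \<open>Off \<open>[L]\<close> the semiflow needs a bounded time to reach a neighborhood of the rest points, so that
  points near \<open>[L]\<close>, which stay away from the rest points for a long time, reach \<open>[L]\<close>.\<close>

lemma covering_by_visiting_sets:
  obtains m :: nat and W :: "'a \<Rightarrow> 'a set" and Q :: "'a option set"
  where "\<forall>r\<in>rest_points. openin (top_of_set N) (W r) \<and> W r \<subseteq> N - L \<and>
      contractible_in (top_of_set N) (W r) (N - L)"
    "\<forall>x\<in>N - L. \<Phi> (real m) (Some x) \<noteq> None \<longrightarrow> x \<in> (\<Union>r\<in>rest_points. W r)"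
    "openin Z Q" "None \<in> Q" "\<forall>z\<in>Q. \<Phi> (real m) z = None"
proof -
  have "\<forall>r\<in>rest_points. \<exists>\<rho>. continuous_on UNIV \<rho> \<and> \<rho> r = 1 \<and> (\<forall>x\<in>L. \<rho> x = (0::real)) \<and>
      (\<forall>m. contractible_in (top_of_set N) (visiting_set m \<rho>) (N - L))"
  proof
    fix r assume r: "r \<in> rest_points"
    have r': "open (interior V - L)" "r \<in> interior V - L"
      using rest_point_in_interior[OF r] closed_pair(2) by (auto intro: open_Diff)
    obtain B B' where B: "open B" "r \<in> B" "B' \<subseteq> interior V - L"
      "homotopic_with_canon (\<lambda>_. True) B' B' id (\<lambda>_. r)"
      "no_return B B'"
      using no_return_nbhd[OF r r'] by blast
    \<comment> \<open>Supported in \<open>B\<close> off \<open>L\<close>: positivity detects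
      membership in \<open>B\<close>, and vanishing on \<open>L\<close> allows passage to the
      quotient.\<close>
    obtain \<rho> :: "'a \<Rightarrow> real" where \<rho>: "continuous_on UNIV \<rho>" "\<rho> r = 1" "\<And>y. 0 \<le> \<rho> y"
      "\<And>y. y \<notin> B \<inter> (interior V - L) \<Longrightarrow> \<rho> y = 0"
      using bump_function[of "B \<inter> (interior V - L)" r] B(1,2) r' by blast
    have "contractible_in (top_of_set N) (visiting_set m \<rho>) (N - L)" for m
    proof (rule contractible_visiting_set[OF \<rho>(1,3) _ _ _ B(4,5)])
      show "x \<in> B" if "0 < \<rho> x" for x using \<rho>(4)[of x] that by fastforce
      show "\<rho> x = 0" if "x \<in> L" for x by (rule \<rho>(4)) (use that in blast)
      show "B' \<subseteq> N - L" using B(3) interior_V_subset by blast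
    qed
    moreover have "\<forall>x\<in>L. \<rho> x = 0" using \<rho>(4) by blast
    ultimately show "\<exists>\<rho>. continuous_on UNIV \<rho> \<and> \<rho> r = 1 \<and> (\<forall>x\<in>L. \<rho> x = (0::real)) \<and>
        (\<forall>m. contractible_in (top_of_set N) (visiting_set m \<rho>) (N - L))"
      using \<rho>(1,2) by blast
  qed
  from bchoice[OF this] obtain \<rho> where "\<forall>r\<in>rest_points. continuous_on UNIV (\<rho> r) \<and>
      \<rho> r r = 1 \<and> (\<forall>x\<in>L. \<rho> r x = (0::real)) \<and>
      (\<forall>m. contractible_in (top_of_set N) (visiting_set m (\<rho> r)) (N - L))" ..
  then have \<rho>: "continuous_on UNIV (\<rho> r)" "\<rho> r r = 1" "x \<in> L \<Longrightarrow> \<rho> r x = 0"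
    "contractible_in (top_of_set N) (visiting_set m (\<rho> r)) (N - L)" if "r \<in> rest_points" for r x m
    using that by blast+
  obtain m :: nat where m: "\<forall>x. (\<forall>t\<in>{0..real m}. \<phi> t x \<in> V) \<longrightarrow>
      (\<exists>n<m. \<exists>r\<in>rest_points. \<rho> r (\<phi> (real n) x) > 1 / 2)"
    using hitting_time_bound[of \<rho>] \<rho>(1,2) by blast
  have hit: "\<exists>n<m. \<exists>r\<in>rest_points. collapsed (\<rho> r) (\<Phi> (real n) (Some x)) > 1 / 2"
    if "\<Phi> (real m) (Some x) \<noteq> None" for x
  proof -
    have in_NL: "\<phi> s x \<in> N - L" if "s \<in> {0..real m}" for s
      using \<open>\<Phi> (real m) (Some x) \<noteq> None\<close> that by (auto simp: \<Phi>_Some split: if_splits)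
    then obtain n r where n: "n < m" "r \<in> rest_points" "\<rho> r (\<phi> (real n) x) > 1 / 2"
      using m NL_subset_V by blast
    have "\<Phi> (real n) (Some x) = Some (\<phi> (real n) x)"
      using in_NL n(1) by (auto simp: \<Phi>_Some)
    with n(3) have "collapsed (\<rho> r) (\<Phi> (real n) (Some x)) > 1 / 2" by (simp add: collapsed_def)
    with n(1,2) show ?thesis by blast
  qed
  define W where "W r = visiting_set m (\<rho> r)" for r
  \<comment> \<open>By \<open>hit\<close>, survival to time \<open>m\<close> forces a value above
    1/2; \<open>Q\<close> demands values below 1/2 throughout. At \<open>None\<close> all values are
    0, and finitely many strict conditions define an open set.\<close>
  define Q where "Q = topspace Z \<inter> (\<Inter>(n, r)\<in>{..<m} \<times> rest_points.
    {z \<in> topspace Z. collapsed (\<rho> r) (\<Phi> (real n) z) \<in> {..<1 / 2}})"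
  show thesis
  proof (rule that[of W m Q])
    show "\<forall>r\<in>rest_points. openin (top_of_set N) (W r) \<and> W r \<subseteq> N - L \<and>
        contractible_in (top_of_set N) (W r) (N - L)"
      using openin_visiting_set \<rho>(1,3,4) by (auto simp: W_def visiting_set_def)
    show "\<forall>x\<in>N - L. \<Phi> (real m) (Some x) \<noteq> None \<longrightarrow> x \<in> (\<Union>r\<in>rest_points. W r)"
    proof (intro ballI impI)
      fix x assume x: "x \<in> N - L" "\<Phi> (real m) (Some x) \<noteq> None"
      obtain n r where "n < m" "r \<in> rest_points" "collapsed (\<rho> r) (\<Phi> (real n) (Some x)) > 1 / 2"
        using hit[OF x(2)] by blast
      moreover from this(3) have "collapsed (\<rho> r) (\<Phi> (real n) (Some x)) > 0" by linarith
      ultimately have "x \<in> W r" "r \<in> rest_points"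
        using x(1) unfolding W_def visiting_set_def by blast+
      then show "x \<in> (\<Union>r\<in>rest_points. W r)" by blast
    qed
    have "openin Z {z \<in> topspace Z. collapsed (\<rho> r) (\<Phi> (real n) z) \<in> {..<1 / 2}}"
      if "r \<in> rest_points" for n r
    proof (rule openin_continuous_map_preimage)
      show "continuous_map Z euclidean (\<lambda>z. collapsed (\<rho> r) (\<Phi> (real n) z))"
        using continuous_map_compose[OF continuous_map_\<Phi>[of "real n"] continuous_map_collapsed[of "\<rho> r"]]
          \<rho>(1,3) that by (simp add: o_def)
    qed simp
    then show "openin Z Q"
      unfolding Q_def using finite_rest_points by (intro openin_Int_Inter) auto
    show "None \<in> Q" by (auto simp: Q_def topspace_Z collapsed_def)
    show "\<forall>z\<in>Q. \<Phi> (real m) z = None"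
    proof (rule ballI, rule ccontr)
      fix z assume z: "z \<in> Q" "\<Phi> (real m) z \<noteq> None"
      then obtain x where "z = Some x" by (cases z) auto
      then obtain n r where n: "n < m" "r \<in> rest_points" "collapsed (\<rho> r) (\<Phi> (real n) z) > 1 / 2"
        using hit z(2) by blast
      then have "collapsed (\<rho> r) (\<Phi> (real n) z) < 1 / 2" using z(1) by (auto simp: Q_def)
      with n(3) show False by simp
    qed
  qed
qed

section \<open>Retraction onto the collapsed point\<close>

text \<open>The semiflow runs for time \<open>s / (1 - s)\<close> and ends at \<open>None\<close>
  for \<open>s = 1\<close>. The end is reached continuously because a point that enters
  \<open>Q\<close> at time \<open>t\<close> has neighbors that do so too, and all of them are at
  \<open>None\<close> from time \<open>t + real m\<close> on.\<close>

lemma deformation_retract_exiting_set: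
  assumes Q: "openin Z Q" "None \<in> Q" "\<And>z. z \<in> Q \<Longrightarrow> \<Phi> (real m) z = None"
    and U: "U = {z \<in> topspace Z. \<exists>t\<ge>0. \<Phi> t z = None}"
  shows "openin Z U" "deformation_retract_in Z {None} U"
proof -
  have later: "\<Phi> s z = None" if "\<Phi> t z = None" "0 \<le> t" "t \<le> s" for s t z
    using \<Phi>_add[of "s - t" t z] that by simp
  \<comment> \<open>\<open>{None}\<close> may fail to be open; \<open>Q\<close> replaces it at the
    price of \<open>real m\<close> more units of time.\<close>
  have "U = (\<Union>t\<in>{0..}. {z \<in> topspace Z. \<Phi> t z \<in> Q})"
  proof (intro equalityI subsetI)
    fix z assume "z \<in> (\<Union>t\<in>{0..}. {z \<in> topspace Z. \<Phi> t z \<in> Q})"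
    then obtain t where t: "0 \<le> t" "z \<in> topspace Z" "\<Phi> t z \<in> Q" by auto
    then have "\<Phi> (real m + t) z = None" using \<Phi>_add[of "real m" t z] Q(3) by simp
    with t show "z \<in> U" unfolding U by (intro CollectI conjI exI[of _ "real m + t"]) auto
  next
    fix z assume "z \<in> U"
    then obtain t where "0 \<le> t" "z \<in> topspace Z" "\<Phi> t z \<in> Q" using Q(2) by (auto simp: U)
    then show "z \<in> (\<Union>t\<in>{0..}. {z \<in> topspace Z. \<Phi> t z \<in> Q})" by auto
  qed
  moreover have "openin Z {z \<in> topspace Z. \<Phi> t z \<in> Q}" if "t \<in> {0..}" for t
    using openin_continuous_map_preimage[OF continuous_map_\<Phi> Q(1)] that by auto
  ultimately show openU: "openin Z U" by auto
  have NoneU: "None \<in> U" by (auto simp: U topspace_Z intro: exI[of _ 0])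
  have UZ: "U \<subseteq> topspace Z" by (auto simp: U)
  define ZU where "ZU = subtopology Z U"
  have top: "topspace ZU = U" using UZ by (auto simp: ZU_def)
  define H where "H p = (if fst p < 1 then \<Phi> (fst p / (1 - fst p)) (snd p) else None)"
    for p :: "real \<times> 'a option"
  define X where "X = prod_topology (top_of_set {0..1::real}) ZU"
  have topX: "topspace X = {0..1} \<times> U" by (simp add: X_def top)
  \<comment> \<open>\<open>(t + real m) / (1 + t + real m)\<close> is the parameter \<open>s\<close>
    with \<open>s / (1 - s) = t + real m\<close>. Beyond it, points that are in \<open>Q\<close> at
    time \<open>t\<close> have collapsed, so the piece that reaches \<open>s = 1\<close> carries the
    constant map.\<close>
  define T where "T i = (if i then {0..<1} \<times> U else
    (\<Union>t\<in>{0..}. {(t + real m) / (1 + t + real m)<..1} \<times> {z \<in> U. \<Phi> t z \<in> Q}))" for i :: bool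
  define F :: "bool \<Rightarrow> real \<times> 'a option \<Rightarrow> 'a option" where "F i = (if i then \<lambda>p. \<Phi> (fst p / (1 - fst p)) (snd p) else (\<lambda>_. None))" for i
  have exit_F: "\<Phi> (s / (1 - s)) z = None" if s: "s < 1" "(s, z) \<in> T False" for s z
  proof -
    obtain t where t: "0 \<le> t" "(t + real m) / (1 + t + real m) < s" "\<Phi> t z \<in> Q"
      using s by (auto simp: T_def)
    have "t + real m < s * (1 + t + real m)"
      using t(1,2) by (simp add: divide_less_eq split: if_splits)
    then have "t + real m \<le> s / (1 - s)"
      using s(1) by (simp add: le_divide_eq algebra_simps)
    moreover have "\<Phi> (t + real m) z = None"
      using \<Phi>_add[of "real m" t z] Q(3)[OF t(3)] t(1) by (simp add: add.commute)
    ultimately show ?thesis using t(1) later[of "t + real m" z "s / (1 - s)"] by simp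
  qed
  have "continuous_map X Z H"
  proof (rule pasting_lemma[of UNIV X T Z F])
    fix i :: bool
    show "openin X (T i)"
    proof (cases i)
      case True
      have "openin (top_of_set {0..1}) {0..<1::real}"
        by (auto simp: openin_open intro!: exI[of _ "{..<1::real}"])
      then show ?thesis using True
        by (simp add: T_def X_def openin_prod_Times_iff flip: top)
    next
      case False
      have "openin X ({c<..1} \<times> {z \<in> U. \<Phi> t z \<in> Q})" if "0 \<le> c" "0 \<le> t" for c t :: real
      proof -
        have "openin (top_of_set {0..1}) {c<..1}"
          using that by (auto simp: openin_open intro!: exI[of _ "{c<..}"])
        moreover have "continuous_map ZU Z (\<Phi> t)"
          unfolding ZU_def by (intro continuous_map_from_subtopology continuous_map_\<Phi> that)
        from openin_continuous_map_preimage[OF this Q(1)]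
        have "openin ZU {z \<in> U. \<Phi> t z \<in> Q}" by (simp add: top)
        ultimately show ?thesis by (simp add: X_def openin_prod_Times_iff)
      qed
      then show ?thesis using False by (auto simp: T_def)
    qed
    show "continuous_map (subtopology X (T i)) Z (F i)"
    proof (cases i)
      case True
      have sub: "subtopology X (T True) = prod_topology (top_of_set {0..<1}) ZU"
        unfolding X_def T_def by (simp add: subtopology_Times subtopology_subtopology Int_absorb1 atLeastLessThan_subseteq_atLeastAtMost_iff flip: top)
      have "continuous_map (top_of_set {0..<1}) (top_of_set {0..}) (\<lambda>s::real. s / (1 - s))"
        by (auto intro!: continuous_intros)
      from continuous_map_compose[OF continuous_map_fst[of _ ZU] this]
      have "continuous_map (prod_topology (top_of_set {0..<1::real}) ZU) (top_of_set {0..}) (\<lambda>p. fst p / (1 - fst p))"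
        by (simp only: o_def)
      moreover have "continuous_map (prod_topology (top_of_set {0..<1::real}) ZU) Z snd"
        using continuous_map_snd continuous_map_into_fulltopology unfolding ZU_def by blast
      ultimately have "continuous_map (prod_topology (top_of_set {0..<1::real}) ZU) (prod_topology Z (top_of_set {0..}))
          (\<lambda>p. (snd p, fst p / (1 - fst p)))"
        by (intro continuous_map_pairedI)
      from continuous_map_compose[OF this continuous_map_semiflow]
      show ?thesis using True by (simp add: sub F_def o_def case_prod_beta)
    next
      case False
      then show ?thesis by (simp add: F_def topspace_Z)
    qed
  next
    fix i j p assume "p \<in> topspace X \<inter> T i \<inter> T j"
    moreover have "F True p = F False p" if "p \<in> T True \<inter> T False"
      using that exit_F[of "fst p" "snd p"] by (auto simp: F_def T_def[of True])
    ultimately show "F i p = F j p" by (cases i; cases j; auto)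
  next
    fix p assume p: "p \<in> topspace X"
    show "\<exists>j. j \<in> UNIV \<and> p \<in> T j \<and> H p = F j p"
    proof (cases "fst p < 1")
      case True
      then show ?thesis using p by (intro exI[of _ True]) (auto simp: T_def F_def H_def topX)
    next
      case False
      then have "fst p = 1" "snd p \<in> U" using p by (auto simp: topX)
      moreover obtain t where "0 \<le> t" "\<Phi> t (snd p) = None" using \<open>snd p \<in> U\<close> by (auto simp: U)
      ultimately show ?thesis using Q(2)
        by (intro exI[of _ False]) (auto simp: T_def F_def H_def mem_Times_iff intro!: bexI[of _ t])
    qed
  qed
  moreover have "H p \<in> U" if p: "p \<in> topspace X" for p
  proof -
    obtain s z where sz: "p = (s, z)" "0 \<le> s" "z \<in> U" using p by (auto simp: topX)
    show ?thesis
    proof (cases "s < 1")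
      case True
      then have u: "0 \<le> s / (1 - s)" using sz by auto
      obtain t where t: "0 \<le> t" "\<Phi> t z = None" using sz by (auto simp: U)
      have "\<Phi> t (\<Phi> (s / (1 - s)) z) = None"
        using later[of t z "t + s / (1 - s)"] t u \<Phi>_add[of t "s / (1 - s)" z] by simp
      then have "\<Phi> (s / (1 - s)) z \<in> U"
        using t(1) \<Phi>_in_Z[OF u] sz UZ by (auto simp: U)
      then show ?thesis using True sz by (simp add: H_def)
    qed (use sz NoneU in \<open>simp add: H_def\<close>)
  qed
  ultimately have contH: "continuous_map X ZU H"
    unfolding ZU_def by (intro continuous_map_into_subtopology) auto
  have "homotopic_with (\<lambda>h. \<forall>a\<in>{None}. h a = a) ZU ZU id (\<lambda>_. None)"
  proof (subst homotopic_with)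
    show "(\<forall>a\<in>{None}. h a = a) \<longleftrightarrow> (\<forall>a\<in>{None}. k a = a)" if "\<And>x. x \<in> topspace ZU \<Longrightarrow> h x = k x" for h k
      using that[of None] NoneU top by auto
    show "\<exists>h. continuous_map (prod_topology (top_of_set {0..1::real}) ZU) ZU h \<and>
        (\<forall>x\<in>topspace ZU. h (0, x) = id x) \<and> (\<forall>x\<in>topspace ZU. h (1, x) = None) \<and>
        (\<forall>t\<in>{0..1}. \<forall>a\<in>{None}. h (t, a) = a)"
      using contH UZ by (intro exI[of _ H]) (auto simp: H_def X_def top \<Phi>_zero)
  qed
  moreover have "retraction_maps ZU (subtopology Z {None}) (\<lambda>_. None) id"
    unfolding retraction_maps_def
  proof (intro conjI)
    show "continuous_map ZU (subtopology Z {None}) (\<lambda>_. None)"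
      by (simp add: topspace_Z)
    show "continuous_map (subtopology Z {None}) ZU id"
      unfolding ZU_def using NoneU by (intro continuous_map_into_subtopology) (auto intro: continuous_map_from_subtopology)
  qed auto
  ultimately show "deformation_retract_in Z {None} U"
    unfolding deformation_retract_in_def using NoneU ZU_def by auto
qed

lemma relative_category_quotient_le: "relative_category Z {None} \<le> enat (card rest_points)"
proof -
  obtain m W Q where W: "\<forall>r\<in>rest_points. openin (top_of_set N) (W r) \<and> W r \<subseteq> N - L \<and>
      contractible_in (top_of_set N) (W r) (N - L)"
    and cover: "\<forall>x\<in>N - L. \<Phi> (real m) (Some x) \<noteq> None \<longrightarrow> x \<in> (\<Union>r\<in>rest_points. W r)"
    and Q: "openin Z Q" "None \<in> Q" "\<forall>z\<in>Q. \<Phi> (real m) z = None"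
    by (rule covering_by_visiting_sets, rule that)
  define U where "U = {z \<in> topspace Z. \<exists>t\<ge>0. \<Phi> t z = None}"
  note U = deformation_retract_exiting_set[OF Q(1,2) bspec[OF Q(3)] U_def]
  show ?thesis
  proof (rule relative_category_le_card[OF finite_rest_points U, of "\<lambda>r. Some ` W r"])
    fix r assume r: "r \<in> rest_points"
    show "openin Z (Some ` W r)"
      using W r openin_quotient_space_Some by blast
    show "Some ` W r \<subseteq> topspace Z - {None}"
      using W r by (auto simp: topspace_Z)
    show "contractible_in Z (Some ` W r) (topspace Z - {None})"
      using contractible_in_quotient_space[OF closed_pair(2,3)] W r by blast
  next
    show "topspace Z \<subseteq> U \<union> (\<Union>r\<in>rest_points. Some ` W r)"
    proof
      fix z assume z: "z \<in> topspace Z"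
      show "z \<in> U \<union> (\<Union>r\<in>rest_points. Some ` W r)"
      proof (cases "\<Phi> (real m) z = None")
        case True
        then show ?thesis using z by (auto simp: U_def intro: exI[of _ "real m"])
      next
        case False
        then obtain x where "z = Some x" "x \<in> N - L" using z by (auto simp: topspace_Z)
        with False cover show ?thesis by blast
      qed
    qed
  qed
qed

section \<open>Exit times and the regular case\<close>

text \<open>The conversion sends \<open>\<infinity>\<close> to 0, so the value is meaningful only
  where the exit time is finite.\<close>

definition exit_real :: "'a \<Rightarrow> real" where
  "exit_real x = real_of_ereal (exit_time \<phi> N L x)"

lemma exit_time_less_infinity_iff:
  assumes "x \<in> N - L"
  shows "exit_time \<phi> N L x < \<infinity> \<longleftrightarrow> (\<exists>T\<ge>0. \<exists>s\<in>{0..T}. \<phi> s x \<notin> N - L)"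
proof
  let ?E = "{ereal t | t. 0 \<le> t \<and> (\<forall>s\<in>{0..t}. \<phi> s x \<in> N - L)}"
  assume fin: "exit_time \<phi> N L x < \<infinity>"
  show "\<exists>T\<ge>0. \<exists>s\<in>{0..T}. \<phi> s x \<notin> N - L"
  proof (rule ccontr)
    assume "\<not> ?thesis"
    then have "ereal (real n) \<le> exit_time \<phi> N L x" for n
      unfolding exit_time_def using assms by (auto intro!: Sup_upper)
    then have "exit_time \<phi> N L x = \<infinity>"
      by (metis ereal_top linorder_not_less reals_Archimedean2 ereal_less_eq(3) order_trans less_imp_le)
    with fin show False by simp
  qed
next
  assume "\<exists>T\<ge>0. \<exists>s\<in>{0..T}. \<phi> s x \<notin> N - L"
  then obtain T s where T: "0 \<le> s" "s \<le> T" "\<phi> s x \<notin> N - L" by auto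
  have "exit_time \<phi> N L x \<le> ereal s"
    unfolding exit_time_def using assms T by (auto intro!: Sup_least)
  then show "exit_time \<phi> N L x < \<infinity>" using le_less_trans by fastforce
qed

lemma exit_time_eq:
  assumes "x \<in> N - L" "exit_time \<phi> N L x < \<infinity>"
  shows "exit_time \<phi> N L x = ereal (exit_real x)" "0 \<le> exit_real x"
proof -
  have "ereal 0 \<le> exit_time \<phi> N L x"
    unfolding exit_time_def using assms(1) by (auto intro!: Sup_upper simp: flow_zero)
  then show "exit_time \<phi> N L x = ereal (exit_real x)" "0 \<le> exit_real x"
    using assms(2) unfolding exit_real_def by (cases "exit_time \<phi> N L x"; auto)+
qed

lemma before_exit:
  assumes x: "x \<in> N - L" "exit_time \<phi> N L x < \<infinity>" and t: "0 \<le> t" "t < exit_real x"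
  shows "\<phi> t x \<in> N - L"
proof -
  have "ereal t < exit_time \<phi> N L x" using exit_time_eq(1)[OF x] t(2) by simp
  then obtain u where "t < u" "\<forall>s\<in>{0..u}. \<phi> s x \<in> N - L"
    unfolding exit_time_def using x(1) by (auto simp: less_Sup_iff)
  then show ?thesis using t(1) by auto
qed

text \<open>Continuity of the semiflow forces orbits to leave \<open>N - L\<close> through \<open>L\<close>: the times \<open>t\<close> with
  \<open>\<phi>\<^sub>\<sharp>\<^sup>t(x) \<noteq> [L]\<close> form a relatively open set.\<close>

lemma at_exit:
  assumes x: "x \<in> N - L" "exit_time \<phi> N L x < \<infinity>"
  shows "\<phi> (exit_real x) x \<in> L" "0 < exit_real x"
proof -
  define T where "T = exit_real x"
  have T: "0 \<le> T" using exit_time_eq(2)[OF x] by (simp add: T_def)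
  have before: "\<phi> t x \<in> N - L" if "0 \<le> t" "t < T" for t
    using before_exit[OF x] that by (simp add: T_def)
  have "\<phi> T x \<in> N"
  proof (cases "T = 0")
    case False
    have "closed ((\<lambda>t. \<phi> t x) -` N)"
      by (rule closed_vimage[OF closed_pair(1)]) (intro continuous_intros)
    then have "closure {0..<T} \<subseteq> (\<lambda>t. \<phi> t x) -` N"
      by (rule closure_minimal[rotated]) (use before in auto)
    then show ?thesis using False T by auto
  qed (use x in \<open>simp add: flow_zero\<close>)
  moreover have "\<phi> T x \<notin> N - L"
  proof
    assume TNL: "\<phi> T x \<in> N - L"
    have "continuous_map (top_of_set {0..}) Z (\<lambda>t. \<Phi> t (Some x))"
    proof -
      have "continuous_map (top_of_set {0..}) (prod_topology Z (top_of_set {0..})) (\<lambda>t::real. (Some x, t))"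
        using x(1) by (intro continuous_map_pairedI) (auto simp: topspace_Z)
      from continuous_map_compose[OF this continuous_map_semiflow] show ?thesis by (simp add: o_def)
    qed
    moreover have "openin Z (Some ` (N - L))"
      using openin_NL openin_quotient_space_Some by blast
    ultimately have "openin (top_of_set {0..}) {t \<in> {0..}. \<Phi> t (Some x) \<in> Some ` (N - L)}"
      using openin_continuous_map_preimage by fastforce
    moreover have "\<forall>s\<in>{0..T}. \<phi> s x \<in> N - L"
      using before TNL by (metis atLeastAtMost_iff order_le_less)
    then have "T \<in> {t \<in> {0..}. \<Phi> t (Some x) \<in> Some ` (N - L)}"
      using T TNL by (auto simp: \<Phi>_Some)
    ultimately obtain e where e: "e > 0"
      "\<And>t. t \<in> {0..} \<Longrightarrow> dist t T < e \<Longrightarrow> \<Phi> t (Some x) \<in> Some ` (N - L)"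
      unfolding openin_euclidean_subtopology_iff by blast
    \<comment> \<open>Survival beyond \<open>T\<close> contradicts that \<open>T\<close> is the
      supremum of the survival times.\<close>
    have "\<Phi> (T + e / 2) (Some x) \<in> Some ` (N - L)"
      using e T by (intro e(2)) (auto simp: dist_real_def)
    then have "\<forall>s\<in>{0..T + e / 2}. \<phi> s x \<in> N - L" by (auto simp: \<Phi>_Some split: if_splits)
    then have "ereal (T + e / 2) \<le> exit_time \<phi> N L x"
      unfolding exit_time_def using x(1) T e(1) by (auto intro!: Sup_upper)
    then show False using exit_time_eq(1)[OF x] e(1) by (simp add: T_def)
  qed
  ultimately have "\<phi> T x \<in> L" by blast
  then show "\<phi> (exit_real x) x \<in> L" by (simp add: T_def)
  have "T \<noteq> 0" using \<open>\<phi> T x \<in> L\<close> x(1) by (auto simp: flow_zero)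
  with T show "0 < exit_real x" by (simp add: T_def)
qed

lemma exit_in_L:
  assumes "x \<in> L"
  shows "exit_time \<phi> N L x = 0" "exit_real x = 0"
  using assms by (auto simp: exit_time_def exit_real_def)

text \<open>Keeps the homotopy of \<open>deformation_retract_regular\<close> inside
  \<open>U\<close>: a point part of the way along still reaches \<open>L\<close> after the remaining
  \<open>(1 - s) * exit_real x\<close>.\<close>

lemma exit_time_along_flow:
  assumes x: "x \<in> N" "exit_time \<phi> N L x < \<infinity>" and s: "s \<in> {0..1}"
  shows "\<phi> (s * exit_real x) x \<in> N \<and> exit_time \<phi> N L (\<phi> (s * exit_real x) x) < \<infinity>"
proof (cases "x \<in> L")
  case True
  then show ?thesis using x by (simp add: exit_in_L flow_zero)
next
  case False
  then have xNL: "x \<in> N - L" using x by simp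
  note e = at_exit[OF xNL x(2)]
  show ?thesis
  proof (cases "s = 1")
    case True
    then show ?thesis using e(1) closed_pair(3) by (auto simp: exit_in_L)
  next
    case False
    then have "s * exit_real x < exit_real x" "0 \<le> s * exit_real x" using s e(2) by auto
    then have y: "\<phi> (s * exit_real x) x \<in> N - L" using before_exit[OF xNL x(2)] by blast
    have "(1 - s) * exit_real x \<ge> 0" using s e(2) by auto
    moreover have "\<phi> ((1 - s) * exit_real x) (\<phi> (s * exit_real x) x) = \<phi> (exit_real x) x"
      by (simp add: algebra_simps flip: flow_plus)
    ultimately have "exit_time \<phi> N L (\<phi> (s * exit_real x) x) < \<infinity>"
      unfolding exit_time_less_infinity_iff[OF y] using e(1)
      by (intro exI[of _ "(1 - s) * exit_real x"] conjI bexI[of _ "(1 - s) * exit_real x"]) auto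
    with y show ?thesis by blast
  qed
qed

text \<open>Continuity of the exit time makes \<open>U\<close> open and lets each point run linearly
  up to its exit. Points of \<open>L\<close> have exit time 0 and stay fixed, and
  \<open>at_exit\<close> places the endpoints in \<open>L\<close>.\<close>

lemma deformation_retract_regular:
  assumes reg: "continuous_on N (exit_time \<phi> N L)"
    and U: "U = {x \<in> N. exit_time \<phi> N L x < \<infinity>}"
  shows "openin (top_of_set N) U" "deformation_retract_in (top_of_set N) L U"
proof -
  have "openin (top_of_set N) (N \<inter> exit_time \<phi> N L -` {..<\<infinity>})"
    by (rule continuous_openin_preimage_gen[OF reg]) auto
  also have "N \<inter> exit_time \<phi> N L -` {..<\<infinity>} = U" by (auto simp: U)
  finally show "openin (top_of_set N) U" .
  have UN: "U \<subseteq> N" and LU: "L \<subseteq> U" using closed_pair(3) by (auto simp: U exit_in_L)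
  have sub: "subtopology (top_of_set N) U = top_of_set U" "subtopology (top_of_set N) L = top_of_set L"
    using UN closed_pair(3) by (simp_all add: subtopology_subtopology Int_absorb1)
  have "\<bar>exit_time \<phi> N L x\<bar> \<noteq> \<infinity>" if "x \<in> U" for x
    using that exit_time_eq(1)[of x] exit_in_L(1)[of x] by (cases "x \<in> L") (auto simp: U)
  then have "continuous_on U (real_of_ereal \<circ> exit_time \<phi> N L)"
    using continuous_on_iff_real continuous_on_subset[OF reg UN] by blast
  then have cont: "continuous_on U exit_real"
    by (simp add: exit_real_def[abs_def] o_def)
  define H where "H = (\<lambda>(s, x). \<phi> (s * exit_real x) x)"
  have contH: "continuous_on ({0..1} \<times> U) H"
    unfolding H_def case_prod_beta by (intro continuous_intros continuous_on_compose2[OF cont]) auto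
  have HU: "H (s, x) \<in> U" if "s \<in> {0..1}" "x \<in> U" for s x
    using exit_time_along_flow[of x s] that by (simp add: H_def U)
  have HL: "H (s, x) = x" if "x \<in> L" for s x
    using that by (simp add: H_def exit_in_L flow_zero)
  have H0: "H (0, x) = x" for x by (simp add: H_def flow_zero)
  have H1: "H (1, x) \<in> L" if "x \<in> U" for x
  proof (cases "x \<in> L")
    case True
    then show ?thesis using HL[OF True, of 1] by simp
  next
    case False
    then show ?thesis using that at_exit(1)[of x] by (simp add: H_def U)
  qed
  have "homotopic_with (\<lambda>h. \<forall>a\<in>L. h a = a) (top_of_set U) (top_of_set U) id (\<lambda>x. H (1, x))"
    unfolding homotopic_with_def
  proof (intro exI[of _ H] conjI allI ballI)
    show "continuous_map (prod_topology (top_of_set {0..1}) (top_of_set U)) (top_of_set U) H"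
      using contH HU by (auto simp flip: subtopology_Times euclidean_product_topology)
  qed (use HL H0 in auto)
  moreover have "retraction_maps (top_of_set U) (top_of_set L) (\<lambda>x. H (1, x)) id"
    unfolding retraction_maps_def
  proof (intro conjI)
    have "continuous_on U (\<lambda>x. H (1, x))"
      by (rule continuous_on_compose2[OF contH]) (auto intro: continuous_intros)
    then show "continuous_map (top_of_set U) (top_of_set L) (\<lambda>x. H (1, x))"
      using H1 by auto
    show "continuous_map (top_of_set L) (top_of_set U) id"
      using LU by auto
  qed (use HL in auto)
  ultimately show "deformation_retract_in (top_of_set N) L U"
    unfolding deformation_retract_in_def sub using LU by blast
qed

lemma relative_category_regular_le:
  assumes reg: "continuous_on N (exit_time \<phi> N L)"
  shows "relative_category (top_of_set N) L \<le> enat (card rest_points)"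
proof -
  obtain m :: nat and W where W: "\<forall>r\<in>rest_points. openin (top_of_set N) (W r) \<and> W r \<subseteq> N - L \<and>
      contractible_in (top_of_set N) (W r) (N - L)"
    and cover: "\<forall>x\<in>N - L. \<Phi> (real m) (Some x) \<noteq> None \<longrightarrow> x \<in> (\<Union>r\<in>rest_points. W r)"
    by (rule covering_by_visiting_sets, rule that)
  define U where "U = {x \<in> N. exit_time \<phi> N L x < \<infinity>}"
  note U = deformation_retract_regular[OF reg U_def]
  show ?thesis
  proof (rule relative_category_le_card[OF finite_rest_points U, of W])
    show "topspace (top_of_set N) \<subseteq> U \<union> (\<Union>r\<in>rest_points. W r)"
    proof
      fix x assume x: "x \<in> topspace (top_of_set N)"
      show "x \<in> U \<union> (\<Union>r\<in>rest_points. W r)"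
      proof (cases "x \<in> L \<or> \<Phi> (real m) (Some x) \<noteq> None")
        case True
        then show ?thesis using x cover exit_in_L(1)[of x] by (cases "x \<in> L") (auto simp: U_def)
      next
        case False
        then have xNL: "x \<in> N - L" using x by simp
        moreover have "\<exists>s\<in>{0..real m}. \<phi> s x \<notin> N - L"
          using False by (auto simp: \<Phi>_Some split: if_splits)
        ultimately have "exit_time \<phi> N L x < \<infinity>"
          unfolding exit_time_less_infinity_iff[OF xNL] by (intro exI[of _ "real m"]) auto
        then show ?thesis using xNL by (simp add: U_def)
      qed
    qed
  qed (use W in auto)
qed

end

section \<open>Back to pseudo-gradient fields\<close>

lemma (in gradient_like_index_pair) card_rest_points_le:
  assumes "finite K" "{x \<in> V. g x = 0} \<subseteq> K"
  shows "card rest_points \<le> card K"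
  using zero_slope_at_rest_point assms by (intro card_mono) auto

lemma strict_mono_on_less_imp_less:
  fixes \<alpha> :: "real \<Rightarrow> real"
  assumes "strict_mono_on S \<alpha>" "x \<in> S" "y \<in> S" "\<alpha> x < \<alpha> y"
  shows "x < y"
  using assms by (metis linorder_neqE_linordered_idom order_less_asym strict_mono_onD)

text \<open>Strict monotonicity lets the inequality with \<open>\<alpha>\<close> be read backwards:
  a small slope forces a small differential. Hence zeros of the slope are critical, and sequences
  with slope tending to 0 fall under the Palais-Smale condition.\<close>

lemma pseudo_gradient_index_pair:
  fixes A :: "('a::t3_space, 'b::banach) chart set"
  assumes X: "complete_finsler_manifold A nrm"
    and f: "C1_function A f"
    and Y: "pseudo_gradient A nrm f Y"
    and \<phi>: "flow_of A Y \<phi>"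
    and pair: "index_pair \<phi> N L"
    and V: "V = closure (N - L)"
    and bdd: "bounded (f ` V)"
    and ps: "palais_smale A nrm f V"
    and fin: "finite (critical_points A f \<inter> V)"
  shows "gradient_like_index_pair \<phi> f (\<lambda>x. differential A f x (Y x)) V N L"
    and "{x \<in> V. differential A f x (Y x) = 0} \<subseteq> critical_points A f \<inter> V"
proof -
  have A: "C1_banach_manifold A" and F: "finsler_structure A nrm"
    using X by (simp_all add: complete_finsler_manifold_def)
  define d where "d = differential_norm A nrm f"
  define g where "g x = differential A f x (Y x)" for x
  obtain \<alpha> :: "real \<Rightarrow> real" where \<alpha>: "strict_mono_on {0..} \<alpha>" "\<alpha> 0 = 0" "\<And>x. \<alpha> (d x) \<le> g x"
    using Y unfolding pseudo_gradient_def d_def g_def by blast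
  have d: "0 \<le> d x" for x
    unfolding d_def by (rule differential_norm_nonneg[OF A F f])
  have \<alpha>_pos: "0 < \<alpha> e" if "0 < e" for e
    using strict_mono_onD[OF \<alpha>(1), of 0 e] that \<alpha>(2) by simp
  have d_less: "d x < e" if "g x < \<alpha> e" "0 < e" for x e
    using strict_mono_on_less_imp_less[OF \<alpha>(1), of "d x" e] d[of x] \<alpha>(3)[of x] that by simp
  have g_nonneg: "0 \<le> g x" for x
    using \<alpha>(3)[of x] \<alpha>_pos[of "d x"] d[of x] \<alpha>(2) by (cases "d x = 0") auto
  show zeros: "{x \<in> V. differential A f x (Y x) = 0} \<subseteq> critical_points A f \<inter> V"
  proof
    fix x assume "x \<in> {x \<in> V. differential A f x (Y x) = 0}"
    then have x: "x \<in> V" "g x = 0" by (simp_all add: g_def)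
    \<comment> \<open>\<open>d_less\<close> with \<open>e = d x\<close>: a positive
      \<open>d x\<close> would give \<open>g x = 0 < \<alpha> (d x)\<close> and so
      \<open>d x < d x\<close>.\<close>
    then have "d x \<le> 0"
      using d_less[of x "d x"] \<alpha>_pos[of "d x"] by fastforce
    with critical_point_if_differential_norm_zero[OF A F f] x(1) show "x \<in> critical_points A f \<inter> V"
      by (simp add: d_def)
  qed
  show "gradient_like_index_pair \<phi> f (\<lambda>x. differential A f x (Y x)) V N L"
  proof
    show "\<phi> 0 x = x" for x using \<phi> by (simp add: flow_of_def)
    show "continuous_on UNIV (\<lambda>(t, x). \<phi> t x)" using \<phi> by (simp add: flow_of_def)
    show "\<phi> (s + t) x = \<phi> s (\<phi> t x)" for s t x
      using Y by (intro flow_add[OF _ \<phi>]) (simp add: pseudo_gradient_def)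
    show "continuous_on UNIV f" by (rule C1_function_continuous[OF A f])
    show "((\<lambda>t. f (\<phi> t x)) has_real_derivative differential A f (\<phi> t x) (Y (\<phi> t x))) (at t)" for x t
      by (rule flow_derivative[OF A f \<phi>])
    show "0 \<le> differential A f x (Y x)" for x using g_nonneg by (simp add: g_def)
    show "closed V" by (simp add: V)
    show "bounded (f ` V)" "V = closure (N - L)" "index_pair \<phi> N L" by fact+
    show "finite {x \<in> V. differential A f x (Y x) = 0}" by (rule finite_subset[OF zeros fin])
    show "\<exists>l r. strict_mono (r :: nat \<Rightarrow> nat) \<and> (\<sigma> \<circ> r) \<longlonglongrightarrow> l"
      if \<sigma>: "range \<sigma> \<subseteq> V" "(\<lambda>n. differential A f (\<sigma> n) (Y (\<sigma> n))) \<longlonglongrightarrow> 0" for \<sigma> :: "nat \<Rightarrow> 'a"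
    proof -
      have "(\<lambda>n. d (\<sigma> n)) \<longlonglongrightarrow> 0"
      proof (rule order_tendstoI)
        show "\<forall>\<^sub>F n in sequentially. a < d (\<sigma> n)" if "a < 0" for a
          by (rule always_eventually) (use that d less_le_trans in blast)
        show "\<forall>\<^sub>F n in sequentially. d (\<sigma> n) < a" if "0 < a" for a
          using order_tendstoD(2)[OF \<sigma>(2) \<alpha>_pos[OF that]]
          by eventually_elim (rule d_less, auto simp: g_def that)
      qed
      moreover have "bounded (range (f \<circ> \<sigma>))"
        by (rule bounded_subset[OF bdd]) (use \<sigma>(1) in auto)
      ultimately show ?thesis
        using ps \<sigma>(1) unfolding palais_smale_def d_def by blast
    qed
    show "\<exists>\<rho> :: 'a \<Rightarrow> real. continuous_on UNIV \<rho> \<and> \<rho> x = 1 \<and> (\<forall>y. 0 \<le> \<rho> y) \<and> (\<forall>y. y \<notin> G \<longrightarrow> \<rho> y = 0)"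
      if "open G" "x \<in> G" for G :: "'a set" and x
      using manifold_bump_function[OF A that] by metis
    show "\<exists>B. open B \<and> x \<in> B \<and> B \<subseteq> G \<and> homotopic_with_canon (\<lambda>_. True) B B id (\<lambda>_. x)"
      if "open G" "x \<in> G" for G :: "'a set" and x
      using manifold_contractible_nbhd[OF A that] by metis
  qed
qed

theorem theorem4p6:
  fixes A :: "('a::t3_space, 'b::banach) chart set"
    and nrm :: "'a \<Rightarrow> ('a, 'b) tvec \<Rightarrow> real"
    and f :: "'a \<Rightarrow> real"
    and Y :: "'a \<Rightarrow> ('a, 'b) tvec"
    and \<phi> :: "real \<Rightarrow> 'a \<Rightarrow> 'a"
    and N L V :: "'a set"
  assumes "complete_finsler_manifold A nrm"
    and "C1_function A f"
    and "pseudo_gradient A nrm f Y"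
    and "flow_of A Y \<phi>"
    and "index_pair \<phi> N L"
    and "V = closure (N - L)"
    and "bounded (f ` V)"
    and "palais_smale A nrm f V"
  shows "relative_category (quotient_space N L) {None} \<le> ecard (critical_points A f \<inter> V) \<and>
    (regular_index_pair \<phi> N L \<longrightarrow>
       relative_category (top_of_set N) L \<le> ecard (critical_points A f \<inter> V))"
proof (cases "finite (critical_points A f \<inter> V)")
  \<comment> \<open>In the other case \<open>ecard\<close> is \<open>\<infinity>\<close> and both
    bounds are trivial.\<close>
  case True
  interpret gradient_like_index_pair \<phi> f "\<lambda>x. differential A f x (Y x)" V N L
    by (rule pseudo_gradient_index_pair(1)[OF assms True])
  have "enat (card rest_points) \<le> ecard (critical_points A f \<inter> V)"
    using card_rest_points_le[OF True pseudo_gradient_index_pair(2)[OF assms True]] True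
    by (simp add: ecard_def)
  then show ?thesis
    using relative_category_quotient_le relative_category_regular_le
    unfolding regular_index_pair_def by (meson order_trans)
qed (simp add: ecard_def)

end
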